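(* $\mathrm{PSD}\setminus\mathrm{PRT[T,O]}\neq\emptyset$.
   Context: An indexed family is a sequence $\mathcal F=(F_n)_{n\in\mathbb N}$ of subsets of $\mathbb N$ that is uniformly computably enumerable; $F\in\mathcal F$ means $F=F_n$ for some $n$, and $\mathrm{mi}_{\mathcal F}(F)$ is the least $n$ with $F_n=F$. An enumeration of a nonempty set $A$ is an infinite sequence of elements of $A$ in which every element of $A$ occurs; $f\restriction n$ is its initial segment of length $n$, and $\mathrm{content}(\sigma)$ is the set of entries of a finite string $\sigma$. A learner is a partial computable function from finite strings of naturals to naturals; hypothesis $h$ is interpreted as $F_h$. PSD is the class of indexed families $\mathcal F$ for which there are a learner $M$ and a polynomial $p$ such that for every $F\in\mathcal F$ and every enumeration $f$ of $F$, there is $n$ with $|\mathrm{content}(f\restriction n)|<p(\mathrm{mi}_{\mathcal F}(F))$ such that $M(f\restriction j)=M(f\restriction n)$ for all $j\ge n$ and $F_{M(f\restriction n)}=F$. A teacher is a computable map $T$ on finite strings with $T(\sigma)$ a prefix of $T(\tau)$ whenever $\sigma$ is a prefix of $\tau$, and $\mathrm{content}(T(\sigma))\subseteq\mathrm{content}(\sigma)$. PRT[T,O] is the class of indexed families $\mathcal F$ for which there are a learner $M$ with a membership oracle for the target set, a teacher $T$ (with access to the oracle answers $M$ receives) and a polynomial $p$ such that for every $F\in\mathcal F$ and every enumeration $f$ of $F$, $M$, fed $T(f\restriction n)$ in place of $f\restriction n$, converges to an index $h$ with $F_h=F$ in fewer than $p(\mathrm{mi}_{\mathcal F}(F))$ computation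 steps of the learner, using at most $p(\mathrm{mi}_{\mathcal F}(F))$ oracle queries. *)

theory Defs
  imports Main "HOL-Computational_Algebra.Polynomial"
begin

text \<open>Registers hold natural numbers; memory is a function nat => nat.
  Every executed instruction costs one step.  The instruction Query r a
  asks the oracle whether the number in register a belongs to the oracle set
  and stores 1 (yes) or 0 (no) in register r.  Programs that are meant to be
  oracle-free (plain computable functions) are run with the empty oracle,
  so queries are harmless for them.\<close>

datatype instr =
    Const nat nat
  | Add nat nat nat
  | Sub nat nat nat
  | Load nat nat
  | Store nat nat
  | Jz nat nat
  | Query nat nat
  | Halt

type_synonym prog = "instr list"
type_synonym config = "nat \<times> (nat \<Rightarrow> nat) \<times> (nat \<times> bool) list"
  \<comment> \<open>program counter, memory, oracle queries asked so far (with answers)\<close>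

definition halted :: "prog \<Rightarrow> nat \<Rightarrow> bool" where
  "halted P pc \<longleftrightarrow> pc \<ge> length P \<or> P ! pc = Halt"

fun exec :: "nat set \<Rightarrow> instr \<Rightarrow> config \<Rightarrow> config" where
  "exec Or (Const r c) (pc, m, qs) = (Suc pc, m(r := c), qs)"
| "exec Or (Add r a b) (pc, m, qs) = (Suc pc, m(r := m a + m b), qs)"
| "exec Or (Sub r a b) (pc, m, qs) = (Suc pc, m(r := m a - m b), qs)"
| "exec Or (Load r a) (pc, m, qs) = (Suc pc, m(r := m (m a)), qs)"
| "exec Or (Store a b) (pc, m, qs) = (Suc pc, m(m a := m b), qs)"
| "exec Or (Jz r l) (pc, m, qs) = ((if m r = 0 then l else Suc pc), m, qs)"
| "exec Or (Query r a) (pc, m, qs) =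
     (Suc pc, m(r := (if m a \<in> Or then 1 else 0)), qs @ [(m a, m a \<in> Or)])"
| "exec Or Halt c = c"

definition step :: "nat set \<Rightarrow> prog \<Rightarrow> config \<Rightarrow> config" where
  "step Or P c = (if halted P (fst c) then c else exec Or (P ! fst c) c)"

definition init :: "nat list \<Rightarrow> config" where
  "init xs = (0, (\<lambda>i. if i = 0 then length xs else if i \<le> length xs then xs ! (i - 1) else 0), [])"

definition run :: "nat set \<Rightarrow> prog \<Rightarrow> nat list \<Rightarrow> nat \<Rightarrow> config" where
  "run Or P xs t = (step Or P ^^ t) (init xs)"

definition halts :: "nat set \<Rightarrow> prog \<Rightarrow> nat list \<Rightarrow> bool" where
  "halts Or P xs \<longleftrightarrow> (\<exists>t. halted P (fst (run Or P xs t)))"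

definition steps :: "nat set \<Rightarrow> prog \<Rightarrow> nat list \<Rightarrow> nat" where
  "steps Or P xs = (LEAST t. halted P (fst (run Or P xs t)))"

definition final_mem :: "nat set \<Rightarrow> prog \<Rightarrow> nat list \<Rightarrow> nat \<Rightarrow> nat" where
  "final_mem Or P xs = fst (snd (run Or P xs (steps Or P xs)))"

definition queries :: "nat set \<Rightarrow> prog \<Rightarrow> nat list \<Rightarrow> (nat \<times> bool) list" where
  "queries Or P xs = snd (snd (run Or P xs (steps Or P xs)))"

definition out_nat :: "nat set \<Rightarrow> prog \<Rightarrow> nat list \<Rightarrow> nat" where
  "out_nat Or P xs = final_mem Or P xs 0"

definition out_list :: "nat set \<Rightarrow> prog \<Rightarrow> nat list \<Rightarrow> nat list" where
  "out_list Or P xs = map (\<lambda>i. final_mem Or P xs (Suc i)) [0..<final_mem Or P xs 0]"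

definition indexed_family :: "(nat \<Rightarrow> nat set) \<Rightarrow> bool" where
  "indexed_family F \<longleftrightarrow> (\<exists>P. \<forall>n x. x \<in> F n \<longleftrightarrow> halts {} P [n, x])"

definition mi :: "(nat \<Rightarrow> nat set) \<Rightarrow> nat set \<Rightarrow> nat" where
  "mi F A = (LEAST n. F n = A)"

definition is_enum :: "nat set \<Rightarrow> (nat \<Rightarrow> nat) \<Rightarrow> bool" where
  "is_enum A f \<longleftrightarrow> A \<noteq> {} \<and> range f = A"

definition pre :: "(nat \<Rightarrow> nat) \<Rightarrow> nat \<Rightarrow> nat list" where
  "pre f n = map f [0..<n]"

definition PSD :: "(nat \<Rightarrow> nat set) \<Rightarrow> bool" where
  "PSD F \<longleftrightarrow> indexed_family F \<and>
    (\<exists>(M::prog) (p::nat poly). \<forall>A\<in>range F. \<forall>f. is_enum A f \<longrightarrow>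
       (\<exists>n. card (set (pre f n)) < poly p (mi F A)
          \<and> (\<forall>j\<ge>n. halts {} M (pre f j) \<and> out_nat {} M (pre f j) = out_nat {} M (pre f n))
          \<and> F (out_nat {} M (pre f n)) = A))"

text \<open>Input to the teacher: the data sequence sigma together with the transcript
  of all oracle queries/answers the learner has received so far.\<close>
definition teach_in :: "nat list \<Rightarrow> (nat \<times> bool) list \<Rightarrow> nat list" where
  "teach_in \<sigma> tr = length \<sigma> # \<sigma> @ concat (map (\<lambda>(q, b). [q, if b then 1 else 0]) tr)"

fun transcript :: "prog \<Rightarrow> prog \<Rightarrow> nat set \<Rightarrow> (nat \<Rightarrow> nat) \<Rightarrow> nat \<Rightarrow> (nat \<times> bool) list" where
  "transcript M T A f 0 = []"
| "transcript M T A f (Suc n) =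
     transcript M T A f n @ queries A M (out_list {} T (teach_in (pre f n) (transcript M T A f n)))"

definition tout :: "prog \<Rightarrow> prog \<Rightarrow> nat set \<Rightarrow> (nat \<Rightarrow> nat) \<Rightarrow> nat \<Rightarrow> nat list" where
  "tout M T A f n = out_list {} T (teach_in (pre f n) (transcript M T A f n))"

definition PRT_TO :: "(nat \<Rightarrow> nat set) \<Rightarrow> bool" where
  "PRT_TO F \<longleftrightarrow> indexed_family F \<and>
    (\<exists>(M::prog) (T::prog) (p::nat poly). \<forall>A\<in>range F. \<forall>f. is_enum A f \<longrightarrow>
       (\<forall>j. halts {} T (teach_in (pre f j) (transcript M T A f j)))
     \<and> (\<forall>j k. j \<le> k \<longrightarrow> (\<exists>u. tout M T A f k = tout M T A f j @ u))
     \<and> (\<forall>j. set (tout M T A f j) \<subseteq> set (pre f j))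
     \<and> (\<exists>n. (\<forall>j\<le>n. halts A M (tout M T A f j))
          \<and> (\<forall>j\<ge>n. halts A M (tout M T A f j)
                   \<and> out_nat A M (tout M T A f j) = out_nat A M (tout M T A f n))
          \<and> F (out_nat A M (tout M T A f n)) = A
          \<and> (\<Sum>s\<in>tout M T A f ` {..n}. steps A M s) < poly p (mi F A)
          \<and> (\<Sum>s\<in>tout M T A f ` {..n}. length (queries A M s)) \<le> poly p (mi F A)))"

end

theory Submission
  imports Defs "HOL-Library.Countable_Set"
begin

text \<open>
  A learner run for few steps on an input of length \<open>L\<close> only forms numbers \<open>\<alpha> * L + \<gamma>\<close> with
  \<open>\<alpha>\<close>, \<open>\<gamma>\<close> of moderate size, so a teacher can communicate a huge number only through the length of
  its message, and lengths never decrease.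

  For each \<open>e\<close> the family contains \<open>{a}\<close>, \<open>{a, b\<^sub>i}\<close>, \<open>{a, b\<^sub>i, c\<^sub>i}\<close> and \<open>{a, b\<^sub>i, d\<^sub>i}\<close> for
  \<open>i < 2 ^ e\<close>.  The triples have small indices, \<open>{a}\<close> has an index far above all elements, and the index
  of \<open>{a, b\<^sub>i}\<close> as well as \<open>c\<^sub>i\<close>, \<open>d\<^sub>i\<close> lie far above \<open>b\<^sub>i\<close>, but all of these belong to a window of
  numbers that shrinks rapidly as \<open>i\<close> grows.  The maximum of a set determines its index, so the
  family is in PSD with constant bound.

  A learner that is fast on the triples has time to query only a few windows while it sees \<open>a\<close>; because
  lengths increase, it must pass over some window \<open>i\<close> before it can query window \<open>0\<close> or output the index of
  \<open>{a}\<close>.  From then on messages are too long for the numbers of window \<open>i\<close>: shown \<open>b\<^sub>i\<close>, the learner can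
  neither query \<open>c\<^sub>i\<close> or \<open>d\<^sub>i\<close> nor output the index of \<open>{a, b\<^sub>i}\<close> quickly.  But without such a query it
  cannot have converged on both \<open>{a, b\<^sub>i, c\<^sub>i}\<close> and \<open>{a, b\<^sub>i, d\<^sub>i}\<close>, so it must be fast on
  \<open>{a, b\<^sub>i}\<close>, a contradiction.
\<close>

section \<open>Programs for elementary functions\<close>

definition reaches :: "prog \<Rightarrow> config \<Rightarrow> config \<Rightarrow> bool" where
  "reaches P c c' \<longleftrightarrow> (\<exists>t. (step {} P ^^ t) c = c')"

lemma reaches_eq: "c = c' \<Longrightarrow> reaches P c c'"
  unfolding reaches_def by (rule exI[of _ 0]) simp

lemmas reaches_refl = reaches_eq[OF refl]

lemma reaches_trans:
  assumes "reaches P c c'" "reaches P c' c''"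
  shows "reaches P c c''"
proof -
  obtain t u where "(step {} P ^^ t) c = c'" "(step {} P ^^ u) c' = c''"
    using assms unfolding reaches_def by blast
  then have "(step {} P ^^ (u + t)) c = c''" by (simp add: funpow_add)
  then show ?thesis unfolding reaches_def by blast
qed

lemma reaches_step: "step {} P c = c' \<Longrightarrow> reaches P c c'"
  unfolding reaches_def by (rule exI[of _ 1]) simp

definition placed :: "prog \<Rightarrow> nat \<Rightarrow> instr list \<Rightarrow> bool" where
  "placed P pc cs \<longleftrightarrow> (\<forall>i<length cs. pc + i < length P \<and> P ! (pc + i) = cs ! i)"

lemma placed_nth: "placed P pc [ins] \<longleftrightarrow> pc < length P \<and> P ! pc = ins"
  by (simp add: placed_def)

lemma placed_Cons: "placed P pc (c # cs) \<longleftrightarrow> placed P pc [c] \<and> placed P (Suc pc) cs"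
  by (simp add: placed_def All_less_Suc2)

lemma placed_append:
  "placed P pc (cs @ ds) \<longleftrightarrow> placed P pc cs \<and> placed P (pc + length cs) ds"
proof (induction cs arbitrary: pc)
  case Nil
  then show ?case by (simp add: placed_def)
next
  case (Cons c cs)
  then show ?case using placed_Cons[of P pc c "cs @ ds"] placed_Cons[of P pc c cs] by simp
qed

lemma placed_middle: "placed (us @ cs @ vs) (length us) cs"
  by (simp add: placed_def nth_append)

lemma step_placed:
  assumes "placed P pc [ins]" "ins \<noteq> Halt"
  shows "step {} P (pc, m, qs) = exec {} ins (pc, m, qs)"
  using assms unfolding placed_nth step_def halted_def by simp

lemma reaches_ins:
  assumes "placed P pc [ins]" "ins \<noteq> Halt" "reaches P (exec {} ins (pc, m, qs)) c"
  shows "reaches P (pc, m, qs) c"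
  by (rule reaches_trans[OF reaches_step[OF step_placed[OF assms(1,2)]] assms(3)])

text \<open>The code depends on its position because jump targets are absolute.  Quantifying over
  the argument registers \<open>ls\<close> and the target register \<open>t\<close> makes renaming of variables free.\<close>

definition computes :: "(nat \<Rightarrow> instr list) \<Rightarrow> nat \<Rightarrow> nat list \<Rightarrow> nat \<Rightarrow> (nat list \<Rightarrow> nat) \<Rightarrow> bool" where
  "computes g k ls t f \<longleftrightarrow> (\<forall>pc. length (g pc) = k) \<and>
     (\<forall>pc P m. placed P pc (g pc) \<longrightarrow>
        (\<exists>m'. reaches P (pc, m, []) (pc + k, m', []) \<and>
           m' t = f (map m ls) \<and> (\<forall>r<t. m' r = m r)))"

text \<open>Registers from the target upward are scratch. The arguments lie below the target and
  survive every subcomputation, so fragments with increasing targets can be chained.\<close>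

definition prim :: "nat \<Rightarrow> (nat list \<Rightarrow> nat) \<Rightarrow> bool" where
  "prim n f \<longleftrightarrow> (\<forall>ls t. length ls = n \<longrightarrow> set ls \<subseteq> {..<t} \<longrightarrow> (\<exists>g k. computes g k ls t f))"

lemma computesE:
  assumes "computes g k ls t f" "placed P pc (g pc)"
  obtains m' where "reaches P (pc, m, []) (pc + k, m', [])"
    "m' t = f (map m ls)" "\<And>r. r < t \<Longrightarrow> m' r = m r"
proof -
  have "\<exists>m'. reaches P (pc, m, []) (pc + k, m', []) \<and> m' t = f (map m ls) \<and> (\<forall>r<t. m' r = m r)"
    using assms unfolding computes_def by (elim conjE allE impE)
  then show ?thesis using that by blast
qed

lemma computes_length: "computes g k ls t f \<Longrightarrow> length (g pc) = k"
  unfolding computes_def by blast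

lemma prim_obtain:
  assumes "prim n f" "length ls = n" "set ls \<subseteq> {..<t}"
  obtains g k where "computes g k ls t f"
  using assms unfolding prim_def by blast

section \<open>Closure of \<open>prim\<close> under arithmetic and bounded recursion\<close>

lemma prim_const: "prim n (\<lambda>_. c)"
  unfolding prim_def
proof (intro allI impI exI)
  fix ls :: "nat list" and t
  show "computes (\<lambda>_. [Const t c]) 1 ls t (\<lambda>_. c)"
    unfolding computes_def
  proof (intro conjI allI impI exI)
    fix pc P and m :: "nat \<Rightarrow> nat"
    assume "placed P pc [Const t c]"
    then show "reaches P (pc, m, []) (pc + 1, m(t := c), [])"
      by (rule reaches_ins) (simp_all add: reaches_refl)
  qed simp_all
qed

lemma prim_nth:
  assumes "k < n"
  shows "prim n (\<lambda>xs. xs ! k)"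
  unfolding prim_def
proof (intro allI impI exI)
  fix ls :: "nat list" and t
  assume ls: "length ls = n" "set ls \<subseteq> {..<t}"
  then have k: "ls ! k < t" using assms nth_mem by blast
  let ?cs = "[Const t 0, Add t (ls ! k) t]"
  show "computes (\<lambda>_. ?cs) 2 ls t (\<lambda>xs. xs ! k)"
    unfolding computes_def
  proof (intro conjI allI impI exI)
    fix pc P and m :: "nat \<Rightarrow> nat"
    assume "placed P pc ?cs"
    then have p: "placed P pc [Const t 0]" "placed P (Suc pc) [Add t (ls ! k) t]"
      by (auto simp: placed_Cons[of _ _ _ "[_]"])
    show "reaches P (pc, m, []) (pc + 2, m(t := m (ls ! k)), [])"
      using k by (auto intro!: reaches_ins[OF p(1)] reaches_ins[OF p(2)] simp: reaches_refl)
  qed (use k ls assms in auto)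
qed

lemma prim_tl:
  assumes "prim n f"
  shows "prim (Suc n) (\<lambda>xs. f (tl xs))"
  unfolding prim_def
proof (intro allI impI)
  fix ls :: "nat list" and t
  assume ls: "length ls = Suc n" "set ls \<subseteq> {..<t}"
  then obtain g k where "computes g k (tl ls) t f"
    using prim_obtain[OF assms, of "tl ls" t] by (cases ls) auto
  then have "computes g k ls t (\<lambda>xs. f (tl xs))"
    unfolding computes_def by (simp add: map_tl)
  then show "\<exists>g k. computes g k ls t (\<lambda>xs. f (tl xs))" by blast
qed

lemma prim_binop:
  assumes f: "prim n f" and g: "prim n g"
    and ins: "\<And>r a b pc m. exec {} (ins r a b) (pc, m, []) = (Suc pc, m(r := F (m a) (m b)), [])"
    and nh: "\<And>r a b. ins r a b \<noteq> Halt"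
  shows "prim n (\<lambda>xs. F (f xs) (g xs))"
  unfolding prim_def
proof (intro allI impI)
  fix ls :: "nat list" and t
  assume ls: "length ls = n" "set ls \<subseteq> {..<t}"
  then have ls': "set ls \<subseteq> {..<Suc t}" by auto
  obtain u k where u: "computes u k ls t f" using prim_obtain[OF f ls] .
  obtain v l where v: "computes v l ls (Suc t) g" using prim_obtain[OF g ls(1) ls'] .
  let ?h = "\<lambda>pc. u pc @ v (pc + k) @ [ins t t (Suc t)]"
  have "computes ?h (k + l + 1) ls t (\<lambda>xs. F (f xs) (g xs))"
    unfolding computes_def
  proof (intro conjI allI impI)
    fix pc P and m :: "nat \<Rightarrow> nat"
    assume "placed P pc (?h pc)"
    then have p: "placed P pc (u pc)" "placed P (pc + k) (v (pc + k))"
      "placed P (pc + k + l) [ins t t (Suc t)]"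
      by (simp_all add: placed_append computes_length[OF u] computes_length[OF v])
    obtain m1 where m1: "reaches P (pc, m, []) (pc + k, m1, [])"
      "m1 t = f (map m ls)" "\<And>r. r < t \<Longrightarrow> m1 r = m r"
      using computesE[OF u p(1)] by blast
    obtain m2 where m2: "reaches P (pc + k, m1, []) (pc + k + l, m2, [])"
      "m2 (Suc t) = g (map m1 ls)" "\<And>r. r < Suc t \<Longrightarrow> m2 r = m1 r"
      using computesE[OF v p(2)] by blast
    have "g (map m1 ls) = g (map m ls)" using m1(3) ls by (intro arg_cong[where f = g]) auto
    then have m2t: "m2 (Suc t) = g (map m ls)" "m2 t = f (map m ls)"
      using m1(2) m2(2,3) by auto
    let ?m = "m2(t := F (m2 t) (m2 (Suc t)))"
    have "reaches P (pc + k + l, m2, []) (pc + (k + l + 1), ?m, [])"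
      by (intro reaches_ins[OF p(3) nh]) (simp add: ins reaches_refl add.assoc)
    then have "reaches P (pc, m, []) (pc + (k + l + 1), ?m, [])"
      using m1(1) m2(1) reaches_trans by blast
    then show "\<exists>m'. reaches P (pc, m, []) (pc + (k + l + 1), m', []) \<and>
        m' t = F (f (map m ls)) (g (map m ls)) \<and> (\<forall>r<t. m' r = m r)"
      using m2t m1(3) m2(3) by (intro exI[of _ ?m]) auto
  qed (simp add: computes_length[OF u] computes_length[OF v])
  then show "\<exists>h k. computes h k ls t (\<lambda>xs. F (f xs) (g xs))" by blast
qed

lemma prim_add: "prim n f \<Longrightarrow> prim n g \<Longrightarrow> prim n (\<lambda>xs. f xs + g xs)"
  by (rule prim_binop[where ins = Add]) auto

lemma prim_diff: "prim n f \<Longrightarrow> prim n g \<Longrightarrow> prim n (\<lambda>xs. f xs - g xs)"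
  by (rule prim_binop[where ins = Sub]) auto

text \<open>A counting loop: register \<open>t\<close> holds the accumulator, followed by the round
  number, the rounds left and a scratch cell. The body delivers its value in the scratch cell; the
  jump back is a \<open>Jz\<close> on a cell just set to 0.\<close>

lemma prim_rec:
  assumes c: "prim n c" and z: "prim n z" and b: "prim (Suc (Suc n)) b"
  shows "prim n (\<lambda>xs. rec_nat (z xs) (\<lambda>j acc. b (acc # j # xs)) (c xs))"
  unfolding prim_def
proof (intro allI impI)
  fix ls :: "nat list" and t
  assume ls: "length ls = n" "set ls \<subseteq> {..<t}"
  let ?j = "Suc t" and ?c = "Suc (Suc t)" and ?s = "Suc (Suc (Suc t))"
  have ls': "set ls \<subseteq> {..<?c}" "set (t # ?j # ls) \<subseteq> {..<?s}" "length (t # ?j # ls) = Suc (Suc n)"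
    using ls by auto
  obtain u lu where u: "computes u lu ls t z" using prim_obtain[OF z ls] .
  obtain v lv where v: "computes v lv ls ?c c" using prim_obtain[OF c ls(1) ls'(1)] .
  obtain w lw where w: "computes w lw (t # ?j # ls) ?s b" using prim_obtain[OF b ls'(3,2)] .
  let ?A = "\<lambda>pc. u pc @ v (pc + lu) @ [Const ?j 0]"
  let ?L = "lu + lv + 1"
  let ?tail = "\<lambda>pc. [Const t 0, Add t t ?s, Const ?s 1, Add ?j ?j ?s, Sub ?c ?c ?s, Const ?s 0, Jz ?s (pc + ?L)]"
  let ?h = "\<lambda>pc. ?A pc @ [Jz ?c (pc + ?L + lw + 8)] @ w (pc + ?L + 1) @ ?tail pc"
  note len = computes_length[OF u] computes_length[OF v] computes_length[OF w]
  have "computes ?h (?L + lw + 8) ls t (\<lambda>xs. rec_nat (z xs) (\<lambda>j acc. b (acc # j # xs)) (c xs))"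
    unfolding computes_def
  proof (intro conjI allI impI)
    fix pc show "length (?h pc) = ?L + lw + 8" by (simp add: len)
  next
    fix pc P and m :: "nat \<Rightarrow> nat"
    assume "placed P pc (?h pc)"
    then have p: "placed P pc (u pc)" "placed P (pc + lu) (v (pc + lu))"
        "placed P (pc + lu + lv) [Const ?j 0]" "placed P (pc + ?L) [Jz ?c (pc + ?L + lw + 8)]"
        "placed P (pc + ?L + 1) (w (pc + ?L + 1))" "placed P (pc + ?L + 1 + lw) (?tail pc)"
      by (simp_all add: placed_append len add.assoc del: append_Cons append_Nil)
    define xs where "xs = map m ls"
    define val where "val k = rec_nat (z xs) (\<lambda>j acc. b (acc # j # xs)) k" for k
    obtain m1 where m1: "reaches P (pc, m, []) (pc + lu, m1, [])"
      "m1 t = z xs" "\<And>r. r < t \<Longrightarrow> m1 r = m r"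
      using computesE[OF u p(1)] unfolding xs_def by blast
    have xs1: "map m1 ls = xs" using m1(3) ls(2) unfolding xs_def by auto
    obtain m2 where m2: "reaches P (pc + lu, m1, []) (pc + lu + lv, m2, [])"
      "m2 ?c = c xs" "\<And>r. r < ?c \<Longrightarrow> m2 r = m1 r"
      using computesE[OF v p(2)] xs1 by metis
    have "reaches P (pc + lu + lv, m2, []) (pc + ?L, m2(?j := 0), [])"
      by (rule reaches_ins[OF p(3)]) (simp_all add: reaches_refl add.assoc)
    then have start: "reaches P (pc, m, []) (pc + ?L, m2(?j := 0), [])"
      using m1(1) m2(1) reaches_trans by blast
    \<comment> \<open>Loop invariant: with \<open>j\<close> rounds done and \<open>k\<close> left,
      the accumulator holds \<open>val j\<close>.\<close>
    have loop: "\<exists>m'. reaches P (pc + ?L, m3, []) (pc + ?L + lw + 8, m', []) \<and> m' t = val (j + k) \<and> (\<forall>r<t. m' r = m r)"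
      if "m3 t = val j" "m3 ?j = j" "m3 ?c = k" "\<And>r. r < t \<Longrightarrow> m3 r = m r" for k j m3
      using that
    proof (induction k arbitrary: j m3)
      case 0
      have "reaches P (pc + ?L, m3, []) (pc + ?L + lw + 8, m3, [])"
        by (rule reaches_ins[OF p(4)]) (simp_all add: reaches_refl 0)
      then show ?case using 0 by auto
    next
      case (Suc k)
      have r1: "reaches P (pc + ?L, m3, []) (pc + ?L + 1, m3, [])"
        by (rule reaches_ins[OF p(4)]) (simp_all add: reaches_refl Suc)
      have xs3: "map m3 ls = xs" using Suc.prems(4) ls(2) unfolding xs_def by auto
      have v3: "b (map m3 (t # ?j # ls)) = val (Suc j)"
        using Suc.prems xs3 by (simp add: val_def)
      obtain m4 where m4: "reaches P (pc + ?L + 1, m3, []) (pc + ?L + 1 + lw, m4, [])"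
        "m4 ?s = val (Suc j)" "\<And>r. r < ?s \<Longrightarrow> m4 r = m3 r"
        using computesE[OF w p(5)] v3 by metis
      define m5 where "m5 = m4(t := val (Suc j), ?j := Suc j, ?c := k, ?s := 0)"
      have q: "placed P (pc + ?L + 1 + lw) [Const t 0]" "placed P (Suc (pc + ?L + 1 + lw)) [Add t t ?s]"
        "placed P (Suc (Suc (pc + ?L + 1 + lw))) [Const ?s 1]"
        "placed P (Suc (Suc (Suc (pc + ?L + 1 + lw)))) [Add ?j ?j ?s]"
        "placed P (Suc (Suc (Suc (Suc (pc + ?L + 1 + lw))))) [Sub ?c ?c ?s]"
        "placed P (Suc (Suc (Suc (Suc (Suc (pc + ?L + 1 + lw)))))) [Const ?s 0]"
        "placed P (Suc (Suc (Suc (Suc (Suc (Suc (pc + ?L + 1 + lw))))))) [Jz ?s (pc + ?L)]"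
        using p(6) by (simp_all add: placed_Cons[of _ _ _ "_ # _"])
      have m4v: "m4 ?j = j" "m4 ?c = Suc k" "m4 t = val j" using m4(3) Suc.prems by auto
      have "reaches P (pc + ?L + 1 + lw, m4, []) (pc + ?L, m5, [])"
        by (rule reaches_ins[OF q(1)], simp, simp only: exec.simps,
            rule reaches_ins[OF q(2)], simp, simp only: exec.simps,
            rule reaches_ins[OF q(3)], simp, simp only: exec.simps,
            rule reaches_ins[OF q(4)], simp, simp only: exec.simps,
            rule reaches_ins[OF q(5)], simp, simp only: exec.simps,
            rule reaches_ins[OF q(6)], simp, simp only: exec.simps,
            rule reaches_ins[OF q(7)], simp,
            rule reaches_eq, simp add: m4(2) m4v m5_def fun_eq_iff)
      then have r5: "reaches P (pc + ?L, m3, []) (pc + ?L, m5, [])"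
        using r1 m4(1) reaches_trans by blast
      have "\<exists>m'. reaches P (pc + ?L, m5, []) (pc + ?L + lw + 8, m', []) \<and> m' t = val (Suc j + k) \<and> (\<forall>r<t. m' r = m r)"
        by (rule Suc.IH) (use m4(3) Suc.prems(4) in \<open>auto simp: m5_def\<close>)
      then show ?case using reaches_trans[OF r5] by auto
    qed
    obtain m' where "reaches P (pc + ?L, m2(?j := 0), []) (pc + ?L + lw + 8, m', [])"
       "m' t = val (0 + c xs)" "\<forall>r<t. m' r = m r"
      using loop[of "m2(?j := 0)" 0 "c xs"] m1 m2 by (auto simp: val_def)
    then show "\<exists>m'. reaches P (pc, m, []) (pc + (?L + lw + 8), m', []) \<and>
        m' t = rec_nat (z (map m ls)) (\<lambda>j acc. b (acc # j # map m ls)) (c (map m ls)) \<and> (\<forall>r<t. m' r = m r)"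
      using reaches_trans[OF start] by (intro exI[of _ m']) (simp add: val_def xs_def ac_simps)
  qed
  then show "\<exists>h k. computes h k ls t (\<lambda>xs. rec_nat (z xs) (\<lambda>j acc. b (acc # j # xs)) (c xs))" by blast
qed

lemma prim_mult:
  assumes "prim n f" "prim n g"
  shows "prim n (\<lambda>xs. f xs * g xs)"
proof -
  have "prim (Suc (Suc n)) (\<lambda>ys. ys ! 0 + g (tl (tl ys)))"
    by (intro prim_add prim_nth prim_tl[of "Suc n" "\<lambda>ys. g (tl ys)"] prim_tl assms) simp
  from prim_rec[OF assms(1) prim_const[of _ 0] this]
  have "prim n (\<lambda>xs. rec_nat 0 (\<lambda>j acc. acc + g xs) (f xs))" by simp
  moreover have "rec_nat 0 (\<lambda>j acc. acc + c) k = k * c" for k c :: nat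
    by (induction k) auto
  ultimately show ?thesis by simp
qed

lemma prim_pow2:
  assumes "prim n f"
  shows "prim n (\<lambda>xs. 2 ^ f xs)"
proof -
  have "prim (Suc (Suc n)) (\<lambda>ys. ys ! 0 + ys ! 0)"
    by (intro prim_add prim_nth) simp_all
  from prim_rec[OF assms(1) prim_const[of _ 1] this]
  have "prim n (\<lambda>xs. rec_nat 1 (\<lambda>j acc. acc + acc) (f xs))" by simp
  moreover have "rec_nat 1 (\<lambda>j acc. acc + acc) k = (2::nat) ^ k" for k
    by (induction k) auto
  ultimately show ?thesis by simp
qed

lemma prim_sum:
  assumes "prim n c" "prim (Suc n) (\<lambda>ys. h (hd ys) (tl ys))"
  shows "prim n (\<lambda>xs. \<Sum>j<c xs. h j xs)"
proof -
  have "prim (Suc (Suc n)) (\<lambda>ys. ys ! 0 + h (hd (tl ys)) (tl (tl ys)))"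
    by (intro prim_add prim_nth prim_tl[of "Suc n" "\<lambda>ys. h (hd ys) (tl ys)"] assms) simp
  from prim_rec[OF assms(1) prim_const[of _ 0] this]
  have "prim n (\<lambda>xs. rec_nat 0 (\<lambda>j acc. acc + h j xs) (c xs))" by simp
  moreover have "rec_nat 0 (\<lambda>j acc. acc + h j xs) k = (\<Sum>j<k. h j xs)" for k and xs :: "nat list"
    by (induction k) auto
  ultimately show ?thesis by simp
qed

lemma prim_eq:
  assumes "prim n f" "prim n g"
  shows "prim n (\<lambda>xs. of_bool (f xs = g xs))"
proof -
  have "prim n (\<lambda>xs. 1 - ((f xs - g xs) + (g xs - f xs)))"
    by (intro prim_diff prim_add prim_const assms)
  moreover have "(\<lambda>xs. 1 - ((f xs - g xs) + (g xs - f xs))) = (\<lambda>xs. of_bool (f xs = g xs))"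
    by (auto simp: fun_eq_iff)
  ultimately show ?thesis by simp
qed

section \<open>Runs\<close>

lemma run_Suc: "run Or P xs (Suc t) = step Or P (run Or P xs t)"
  by (simp add: run_def)

lemma run_halted:
  assumes "halted P (fst (run Or P xs u))" "u \<le> t"
  shows "run Or P xs t = run Or P xs u"
  using assms(2)
proof (induction rule: dec_induct)
  case (step t)
  then show ?case using assms(1) by (simp add: run_Suc step_def)
qed simp

lemma halted_steps: "halts Or P xs \<Longrightarrow> halted P (fst (run Or P xs (steps Or P xs)))"
  unfolding halts_def steps_def by (rule LeastI_ex)

lemma steps_le: "halted P (fst (run Or P xs t)) \<Longrightarrow> steps Or P xs \<le> t"
  unfolding steps_def by (rule Least_le)

lemma run_at_halt:
  assumes "halted P (fst (run Or P xs t))"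
  shows "run Or P xs (steps Or P xs) = run Or P xs t"
  using assms run_halted[OF halted_steps steps_le] unfolding halts_def by metis

lemma reaches_halt:
  assumes "reaches P (init xs) (pc, m, qs)" "halted P pc"
  shows "halts {} P xs" "out_nat {} P xs = m 0"
proof -
  obtain t where t: "run {} P xs t = (pc, m, qs)"
    using assms(1) unfolding reaches_def run_def by blast
  then show "halts {} P xs" using assms(2) unfolding halts_def by (metis fst_conv)
  show "out_nat {} P xs = m 0"
    unfolding out_nat_def final_mem_def using run_at_halt[of P "{}" xs t] t assms(2) by simp
qed

text \<open>The computed value is tested by a jump to itself: 0 traps the program there, any other
  value lets it run off the end.\<close>

lemma prim_semidecidable:
  assumes "prim 2 f"
  shows "\<exists>P. \<forall>n x. f [n, x] \<noteq> 0 \<longleftrightarrow> halts {} P [n, x]"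
proof -
  obtain g k where g: "computes g k [1, 2] 3 f"
    using prim_obtain[OF assms, of "[1, 2]" 3] by auto
  define P where "P = g 0 @ [Jz 3 k]"
  have len: "length P = Suc k" using computes_length[OF g] by (simp add: P_def)
  have p: "placed P 0 (g 0)" "placed P k [Jz 3 k]"
    using computes_length[OF g, of 0] placed_middle[of "[]" "g 0"] placed_middle[of "g 0" _ "[]"]
    by (simp_all add: P_def)
  have "f [n, x] \<noteq> 0 \<longleftrightarrow> halts {} P [n, x]" for n x
  proof -
    obtain i where i: "init [n, x] = (0, i, [])" "map i [1, 2] = [n, x]"
      by (simp add: init_def)
    obtain m' where m': "reaches P (init [n, x]) (k, m', [])" "m' 3 = f [n, x]"
      using computesE[OF g p(1), of i] i by auto
    have st: "step {} P (k, m', []) = (if m' 3 = 0 then k else Suc k, m', [])"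
      using step_placed[OF p(2)] by simp
    show ?thesis
    proof (cases "m' 3 = 0")
      case True
      obtain t where t: "run {} P [n, x] t = (k, m', [])"
        using m'(1) unfolding reaches_def run_def by blast
      have nh: "\<not> halted P k"
        using p(2) unfolding placed_nth halted_def by simp
      have "\<not> halted P (fst (run {} P [n, x] u))" for u
      proof
        assume h: "halted P (fst (run {} P [n, x] u))"
        have "run {} P [n, x] (t + v) = (k, m', [])" for v
          by (induction v) (use t st True in \<open>auto simp: run_Suc\<close>)
        then have "run {} P [n, x] (u + t) = (k, m', [])" by (metis add.commute)
        then show False using run_halted[OF h, of "u + t"] nh h by simp
      qed
      then show ?thesis using True m' unfolding halts_def by simp
    next
      case False
      then have "reaches P (init [n, x]) (Suc k, m', [])"
        using reaches_trans[OF m'(1) reaches_step[OF st]] by simp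
      moreover have "halted P (Suc k)" using len by (simp add: halted_def)
      ultimately show ?thesis using reaches_halt(1) False m'(2) by simp
    qed
  qed
  then show ?thesis by blast
qed

text \<open>The input occupies all low registers, so register 2 is freed by replacing register 1 with
  the maximum of the first two entries; registers 0, 1 and 2 then suffice for the loop.\<close>

lemma prim_of_max_learner:
  assumes "prim 1 f"
  shows "\<exists>M. \<forall>xs. halts {} M xs \<and> out_nat {} M xs = f [Max (insert 0 (set xs))]"
proof -
  obtain g k where g: "computes g k [1] 2 f"
    using prim_obtain[OF assms, of "[1]" 2] by auto
  \<comment> \<open>Subtraction is truncated, so \<open>Sub 2 2 1\<close> followed by
    \<open>Add 1 1 2\<close> leaves the maximum of registers 1 and 2 in register 1. Register 0
    becomes a pointer descending from the length to 0.\<close>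
  define M where "M = [Sub 2 2 1, Add 1 1 2, Jz 0 10, Load 2 0, Sub 2 2 1, Add 1 1 2, Const 2 1,
    Sub 0 0 2, Const 2 0, Jz 2 2] @ g 10 @ [Const 0 0, Add 0 2 0]"
  have p: "placed M 0 [Sub 2 2 1]" "placed M 1 [Add 1 1 2]" "placed M 2 [Jz 0 10]" "placed M 3 [Load 2 0]"
    "placed M 4 [Sub 2 2 1]" "placed M 5 [Add 1 1 2]" "placed M 6 [Const 2 1]" "placed M 7 [Sub 0 0 2]"
    "placed M 8 [Const 2 0]" "placed M 9 [Jz 2 2]" "placed M 10 (g 10)"
    "placed M (10 + k) [Const 0 0]" "placed M (Suc (10 + k)) [Add 0 2 0]"
    using computes_length[OF g]
    by (simp_all add: placed_nth M_def nth_append)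
      (use placed_middle[of "[Sub 2 2 1, Add 1 1 2, Jz 0 10, Load 2 0, Sub 2 2 1, Add 1 1 2,
         Const 2 1, Sub 0 0 2, Const 2 0, Jz 2 2]" "g 10"] in \<open>simp add: numeral_eq_Suc\<close>)
  \<comment> \<open>The pointer also visits registers 2 and 1, which no longer hold input. The
    premise makes register 2 harmless, and register 1 is compared with itself.\<close>
  have loop: "\<exists>m'. reaches M (2, m, []) (10, m', []) \<and> m' 1 = Max (insert (m 1) (m ` {3..m 0}))"
    if "m 2 \<le> m 1" for m
    using that
  proof (induction "m 0" arbitrary: m)
    case 0
    have "reaches M (2, m, []) (10, m, [])"
      by (rule reaches_ins[OF p(3)]) (simp_all add: reaches_refl flip: 0(1))
    then show ?case by (intro exI[of _ m]) (simp flip: 0(1))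
  next
    case (Suc q)
    define m1 where "m1 = m(1 := max (m 1) (m (Suc q)), 2 := 0, 0 := q)"
    have r1: "reaches M (2, m, []) (2, m1, [])"
      by (rule reaches_ins[OF p(3)], simp, simp only: exec.simps Suc.hyps(2)[symmetric] if_False nat.simps Suc_numeral Num.add_num_simps,
          rule reaches_ins[OF p(4)], simp, simp only: exec.simps Suc_numeral Num.add_num_simps,
          rule reaches_ins[OF p(5)], simp, simp only: exec.simps Suc_numeral Num.add_num_simps,
          rule reaches_ins[OF p(6)], simp, simp only: exec.simps Suc_numeral Num.add_num_simps,
          rule reaches_ins[OF p(7)], simp, simp only: exec.simps Suc_numeral Num.add_num_simps,
          rule reaches_ins[OF p(8)], simp, simp only: exec.simps Suc_numeral Num.add_num_simps,
          rule reaches_ins[OF p(9)], simp, simp only: exec.simps Suc_numeral Num.add_num_simps,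
          rule reaches_ins[OF p(10)], simp,
          rule reaches_eq, simp add: m1_def fun_eq_iff max_def flip: Suc.hyps(2))
    have "\<exists>m'. reaches M (2, m1, []) (10, m', []) \<and> m' 1 = Max (insert (m1 1) (m1 ` {3..m1 0}))"
      by (rule Suc.hyps(1)) (simp_all add: m1_def)
    moreover have "Max (insert (m1 1) (m1 ` {3..m1 0})) = Max (insert (m 1) (m ` {3..m 0}))"
    proof -
      have im: "m1 ` {3..q} = m ` {3..q}" by (rule image_cong) (auto simp: m1_def)
      show ?thesis
      proof (cases "q < 2")
        case True
        then have "q = 0 \<or> q = 1" by auto
        then have "m (Suc q) \<le> m 1" using Suc.prems by (auto simp: numeral_2_eq_2)
        then show ?thesis using True by (simp add: m1_def flip: Suc.hyps(2))
      next
        case False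
        then have "{3..m 0} = insert (Suc q) {3..q}" using Suc.hyps(2) by auto
        then have "insert (m 1) (m ` {3..m 0}) = insert (m 1) (insert (m (Suc q)) (m ` {3..q}))" by simp
        moreover have "m1 1 = max (m 1) (m (Suc q))" "m1 0 = q" by (simp_all add: m1_def)
        ultimately show ?thesis using im
          by (cases "m ` {3..q} = {}") (simp_all add: max.assoc)
      qed
    qed
    ultimately show ?case using reaches_trans[OF r1] by auto
  qed
  have "halts {} M xs \<and> out_nat {} M xs = f [Max (insert 0 (set xs))]" for xs
  proof -
    obtain i where i: "init xs = (0, i, [])"
      and i0: "i = (\<lambda>j. if j = 0 then length xs else if j \<le> length xs then xs ! (j - 1) else 0)"
      by (simp add: init_def)
    define m0 where "m0 = i(2 := i 2 - i 1, 1 := max (i 1) (i 2))"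
    have r0: "reaches M (init xs) (2, m0, [])" unfolding i
      by (rule reaches_ins[OF p(1)], simp, simp only: exec.simps,
          rule reaches_ins[OF p(2)[unfolded One_nat_def]], simp,
          rule reaches_eq, simp add: m0_def fun_eq_iff)
    obtain m1 where m1: "reaches M (2, m0, []) (10, m1, [])" "m1 1 = Max (insert (m0 1) (m0 ` {3..m0 0}))"
      using loop[of m0] le_trans[OF diff_le_self max.cobounded2] by (auto simp: m0_def)
    have "Max (insert (m0 1) (m0 ` {3..m0 0})) = Max (insert 0 (set xs))" (is "Max ?A = Max ?B")
    proof (rule antisym)
      have mem: "i j \<in> ?B" if "j \<noteq> 0" for j using that by (auto simp: i0)
      have "m0 1 \<in> ?B" using mem[of 1] mem[of 2] by (auto simp: m0_def max_def)
      moreover have "m0 j \<in> ?B" if "3 \<le> j" for j using mem[of j] that by (simp add: m0_def)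
      ultimately have "?A \<subseteq> ?B"
        by (simp only: insert_subset image_subset_iff Ball_def atLeastAtMost_iff) blast
      then show "Max ?A \<le> Max ?B" by (intro Max_mono) auto
      have "x \<le> Max ?A" if "x \<in> ?B" for x
      proof (cases "x \<in> set xs")
        case True
        then obtain j where j: "j < length xs" "x = i (Suc j)" by (auto simp: in_set_conv_nth i0)
        show ?thesis
        proof (cases "j < 2")
          case True
          then have "x \<le> m0 1" using j(2) less_2_cases[OF True] by (auto simp: m0_def simp flip: numeral_2_eq_2)
          also have "\<dots> \<le> Max ?A" by (intro Max_ge) auto
          finally show ?thesis .
        next
          case False
          then have "x = m0 (Suc j)" "Suc j \<in> {3..m0 0}" using j by (auto simp: m0_def i0)
          then show ?thesis by (intro Max_ge) auto
        qed
      qed (use that in simp)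
      then show "Max ?B \<le> Max ?A" by simp
    qed
    then have m11: "m1 1 = Max ?B" using m1(2) by simp
    obtain m2 where m2: "reaches M (10, m1, []) (10 + k, m2, [])" "m2 2 = f [Max ?B]"
      using computesE[OF g p(11), of m1] m11 by auto
    have "reaches M (10 + k, m2, []) (12 + k, m2(0 := m2 2), [])"
      by (rule reaches_ins[OF p(12)], simp, simp only: exec.simps,
          rule reaches_ins[OF p(13)], simp,
          rule reaches_eq, simp add: fun_eq_iff)
    then have "reaches M (init xs) (12 + k, m2(0 := m2 2), [])"
      using reaches_trans[OF reaches_trans[OF r0 m1(1)] reaches_trans[OF m2(1)]] by blast
    moreover have "halted M (12 + k)"
      using computes_length[OF g] by (simp add: halted_def M_def)
    ultimately show ?thesis using reaches_halt[of M xs "12 + k"] m2(2) by simp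
  qed
  then show ?thesis by blast
qed


section \<open>The family\<close>

text \<open>With \<open>u = e + i\<close> the inner sum is \<open>u * u + i\<close> with
  \<open>i <= u\<close>, an injective pairing. A value \<open>k < 4\<close> takes two further bits,
  and the last bit makes the number odd.\<close>

definition tag :: "nat \<Rightarrow> nat \<Rightarrow> nat \<Rightarrow> nat" where
  "tag k e i = 8 * ((e + i) * (e + i) + i) + 2 * k + 1"

text \<open>With \<open>E = 2 ^ e\<close>, the pairs \<open>(e, i)\<close> with \<open>i < E\<close> own windows of numbers around
  \<open>2 ^ (8 * E * (E - i))\<close>, decreasing in \<open>i\<close> and separated by factors of about \<open>2 ^ E\<close>.  The odd
  part \<open>tag k e i\<close> makes all numbers below distinct.\<close>

definition elt :: "nat \<Rightarrow> nat \<Rightarrow> nat \<Rightarrow> nat" where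
  "elt k e i = 2 ^ (2 ^ e * (if k = 0 then 0 else if k = 1 then 8 * (2 ^ e - i) else 8 * (2 ^ e - i) + 4)) * tag k e i"

text \<open>Triples get indices polynomial in \<open>e\<close> and \<open>i\<close>, which forces
  quick success on them. A pair gets the same power of two as the third elements of the triples, so
  one size estimate will exclude both querying those and outputting this index.\<close>

definition idx :: "nat \<Rightarrow> nat \<Rightarrow> nat \<Rightarrow> nat" where
  "idx k e i = 2 ^ (2 ^ e * (if k = 0 then 8 * 2 ^ e + 8 else if k = 1 then 8 * (2 ^ e - i) + 4 else 0)) * tag k e i"

text \<open>The singleton varies with \<open>i\<close> so that the top element determines all three
  parameters; the lower bound uses the one with \<open>i = 0\<close>.\<close>

definition lang :: "nat \<Rightarrow> nat \<Rightarrow> nat \<Rightarrow> nat set" where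
  "lang k e i = (if k = 0 then {elt 0 e i} else {elt 0 e 0, elt 1 e i, elt k e i})"

text \<open>Numbers that are no \<open>idx k e i\<close> index the empty set, which has no
  enumeration.\<close>

definition fam :: "nat \<Rightarrow> nat set" where
  "fam n = {x. \<exists>k<4. \<exists>e i. n = idx k e i \<and> x \<in> lang k e i}"

text \<open>As \<open>i <= u\<close>, the value lies in the interval from \<open>u * u\<close> to
  below \<open>Suc u * Suc u\<close>; these intervals are disjoint for different
  \<open>u\<close>.\<close>

lemma square_add_inject:
  fixes u v :: nat
  assumes "u * u + i = v * v + j" "i \<le> u" "j \<le> v"
  shows "u = v" "i = j"
proof -
  have less: False if "u * u + i = v * v + j" "i \<le> u" "u < v" for u v i j :: nat
  proof -
    have "Suc u * Suc u \<le> v * v" using that by (intro mult_le_mono) auto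
    then show False using that by simp
  qed
  show "u = v" using less[of u i v j] less[of v j u i] assms by (metis nat_neq_iff)
  then show "i = j" using assms by simp
qed

lemma tag_inject:
  assumes "tag k e i = tag k' e' i'" "k < 4" "k' < 4"
  shows "k = k' \<and> e = e' \<and> i = i'"
proof -
  have eq: "4 * ((e + i) * (e + i) + i) + k = 4 * ((e' + i') * (e' + i') + i') + k'"
    using assms(1) by (simp add: tag_def)
  have split: "a = b \<and> k = k'" if "4 * a + k = 4 * b + k'" for a b using that assms(2,3) by presburger
  have kk: "(e + i) * (e + i) + i = (e' + i') * (e' + i') + i'" "k = k'" using split[OF eq] by auto
  show ?thesis using square_add_inject[OF kk(1)] kk(2) by simp
qed

lemma odd_part_unique:
  fixes u v :: nat
  assumes "2 ^ p * u = 2 ^ q * v" "odd u" "odd v"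
  shows "u = v"
proof -
  have le: "u = v" if h: "2 ^ p * u = 2 ^ q * v" "odd u" "p \<le> q" for p q u v :: nat
  proof -
    obtain d where "q = p + d" using h(3) le_Suc_ex by blast
    then have "u = 2 ^ d * v" using h(1) by (simp add: power_add mult.assoc)
    then show ?thesis using h(2) by (cases d) auto
  qed
  show ?thesis using le[of p u q v] le[of q v p u] assms by (metis nat_le_linear)
qed

lemma odd_tag: "odd (tag k e i)"
  by (simp add: tag_def)

text \<open>These bounds make a bounded search for the parameters of a given element or index
  sufficient.\<close>

lemma le_tag: "e \<le> tag k e i" "i \<le> tag k e i"
proof -
  have "e \<le> e + i" by simp
  also have "\<dots> \<le> (e + i) * (e + i)" by simp
  also have "\<dots> \<le> tag k e i" unfolding tag_def by simp
  finally show "e \<le> tag k e i" .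
  show "i \<le> tag k e i" unfolding tag_def by simp
qed

lemma tag_le_elt: "tag k e i \<le> elt k e i"
  by (simp add: elt_def)

lemma tag_le_idx: "tag k e i \<le> idx k e i"
  by (simp add: idx_def)

lemma elt_inject: "elt k e i = elt k' e' i' \<Longrightarrow> k < 4 \<Longrightarrow> k' < 4 \<Longrightarrow> k = k' \<and> e = e' \<and> i = i'"
  unfolding elt_def by (rule tag_inject[OF odd_part_unique]) (simp_all add: odd_tag)

lemma idx_inject: "idx k e i = idx k' e' i' \<Longrightarrow> k < 4 \<Longrightarrow> k' < 4 \<Longrightarrow> k = k' \<and> e = e' \<and> i = i'"
  unfolding idx_def by (rule tag_inject[OF odd_part_unique]) (simp_all add: odd_tag)

lemma elt_mono: "elt 0 e 0 \<le> elt 1 e i" "1 \<le> k \<Longrightarrow> elt 1 e i \<le> elt k e i"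
proof -
  have "e * e \<le> (e + i) * (e + i)" by (intro mult_le_mono) simp_all
  then have "tag 0 e 0 \<le> tag 1 e i" unfolding tag_def by simp
  also have "\<dots> \<le> elt 1 e i" by (rule tag_le_elt)
  finally show "elt 0 e 0 \<le> elt 1 e i" by (simp add: elt_def)
  show "elt 1 e i \<le> elt k e i" if "1 \<le> k"
    unfolding elt_def using that by (intro mult_le_mono power_increasing) (auto simp: tag_def)
qed

text \<open>The maximum identifies a language, by \<open>elt_inject\<close>. Both the uniqueness of
  indices and the PSD learner rest on this.\<close>

lemma Max_lang: "Max (lang k e i) = elt k e i"
proof (cases "k = 0")
  case False
  then have "elt 0 e 0 \<le> elt 1 e i" "elt 1 e i \<le> elt k e i" using elt_mono by simp_all
  then show ?thesis using False unfolding lang_def by (intro Max_eqI) auto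
qed (simp add: lang_def)

lemma finite_lang: "finite (lang k e i)" and lang_nonempty: "lang k e i \<noteq> {}"
  by (simp_all add: lang_def)

lemma fam_idx: "k < 4 \<Longrightarrow> fam (idx k e i) = lang k e i"
  unfolding fam_def by (auto dest: idx_inject)

lemma fam_nonempty: "fam n \<noteq> {} \<Longrightarrow> \<exists>k<4. \<exists>e i. n = idx k e i"
  unfolding fam_def by blast

text \<open>Comparing maxima shows that a language has just one index, so a correct learner must
  output that number, however large it is.\<close>

lemma fam_eq_lang:
  assumes "fam n = lang k e i" "k < 4"
  shows "n = idx k e i"
proof -
  obtain k' e' i' where n: "k' < 4" "n = idx k' e' i'"
    using fam_nonempty[of n] assms(1) lang_nonempty by blast
  then have "lang k' e' i' = lang k e i" using fam_idx assms(1) by simp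
  then have "elt k' e' i' = elt k e i" by (metis Max_lang)
  then show ?thesis using elt_inject n assms(2) by blast
qed

section \<open>The family is uniformly computably enumerable\<close>

lemma prim_hd: "prim (Suc n) hd"
  unfolding prim_def
proof (intro allI impI)
  fix ls :: "nat list" and t
  assume ls: "length ls = Suc n" "set ls \<subseteq> {..<t}"
  obtain g k where "computes g k ls t (\<lambda>xs. xs ! 0)"
    using prim_obtain[OF prim_nth ls] by blast
  then have "computes g k ls t hd" using ls(1) by (cases ls) (simp_all add: computes_def)
  then show "\<exists>g k. computes g k ls t hd" by blast
qed

lemma prim_sum_fixed: "(\<And>k. prim n (f k)) \<Longrightarrow> prim n (\<lambda>xs. \<Sum>k<(K::nat). f k xs)"
proof (induction K)
  case 0
  then show ?case using prim_const[of n 0] by simp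
next
  case (Suc K)
  then show ?case by (simp add: prim_add)
qed

lemma prim_tag: "prim n f \<Longrightarrow> prim n g \<Longrightarrow> prim n (\<lambda>xs. tag k (f xs) (g xs))"
  unfolding tag_def by (intro prim_add prim_mult prim_const)

lemma prim_elt: "prim n f \<Longrightarrow> prim n g \<Longrightarrow> prim n (\<lambda>xs. elt k (f xs) (g xs))"
  unfolding elt_def
  by (cases "k = 0"; cases "k = 1"; simp)
    (intro prim_mult prim_pow2 prim_add prim_diff prim_const prim_tag; assumption)+

lemma prim_idx: "prim n f \<Longrightarrow> prim n g \<Longrightarrow> prim n (\<lambda>xs. idx k (f xs) (g xs))"
  unfolding idx_def
  by (cases "k = 0"; cases "k = 1"; simp)
    (intro prim_mult prim_pow2 prim_add prim_diff prim_const prim_tag; assumption)+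

definition in_lang :: "nat \<Rightarrow> nat \<Rightarrow> nat \<Rightarrow> nat \<Rightarrow> nat" where
  "in_lang k e i x = (if k = 0 then of_bool (elt 0 e i = x)
     else of_bool (elt 0 e 0 = x) + of_bool (elt 1 e i = x) + of_bool (elt k e i = x))"

lemma in_lang: "in_lang k e i x \<noteq> 0 \<longleftrightarrow> x \<in> lang k e i"
  by (auto simp: in_lang_def lang_def)

lemma prim_in_lang:
  assumes "prim n f" "prim n g" "prim n h"
  shows "prim n (\<lambda>xs. in_lang k (f xs) (g xs) (h xs))"
  unfolding in_lang_def
  by (cases "k = 0"; simp) (intro prim_add prim_eq prim_elt prim_const assms)+

lemma prim_double_sum:
  assumes "prim n c" "prim (Suc (Suc n)) (\<lambda>zs. h (hd (tl zs)) (hd zs) (tl (tl zs)))"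
  shows "prim n (\<lambda>xs. \<Sum>e<c xs. \<Sum>i<c xs. h e i xs)"
  using prim_sum[OF assms(1), of "\<lambda>e xs. \<Sum>i<c xs. h e i xs"]
    prim_sum[OF prim_tl[OF assms(1)], of "\<lambda>i ys. h (hd ys) i (tl ys)"] assms(2)
  by simp

text \<open>Membership is decided by a bounded search, written as a sum so that \<open>prim\<close>
  covers it: a nonzero term is a witness with parameters up to \<open>n\<close>.\<close>

lemma indexed_family_fam: "indexed_family fam"
proof -
  define f where "f xs = (\<Sum>e<xs ! 0 + 1. \<Sum>i<xs ! 0 + 1. \<Sum>k<4::nat.
    of_bool (idx k e i = xs ! 0) * in_lang k e i (xs ! 1))" for xs :: "nat list"
  have n: "prim (Suc (Suc 2)) (\<lambda>zs. tl (tl zs) ! 0)" "prim (Suc (Suc 2)) (\<lambda>zs. tl (tl zs) ! 1)"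
    by (rule prim_tl[OF prim_tl[OF prim_nth]], simp)+
  have v: "prim (Suc (Suc 2)) hd" "prim (Suc (Suc 2)) (\<lambda>zs. hd (tl zs))"
    by (rule prim_hd) (rule prim_tl[OF prim_hd])
  have "prim (Suc (Suc 2)) (\<lambda>zs. \<Sum>k<4::nat. of_bool (idx k (hd (tl zs)) (hd zs) = tl (tl zs) ! 0) *
      in_lang k (hd (tl zs)) (hd zs) (tl (tl zs) ! 1))"
    by (intro prim_sum_fixed prim_mult prim_eq prim_idx prim_in_lang n v)
  then have "prim 2 f"
    unfolding f_def by (intro prim_double_sum prim_add prim_nth prim_const) simp_all
  moreover have "x \<in> fam n \<longleftrightarrow> f [n, x] \<noteq> 0" for n x
  proof -
    have "f [n, x] = (\<Sum>e<n + 1. \<Sum>i<n + 1. \<Sum>k<4::nat. of_bool (idx k e i = n) * in_lang k e i x)"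
      by (simp add: f_def)
    then have zero: "f [n, x] = 0 \<longleftrightarrow> (\<forall>e<n + 1. \<forall>i<n + 1. \<forall>k<4. \<not> (idx k e i = n \<and> x \<in> lang k e i))"
      by (simp only: sum_eq_0_iff[OF finite_lessThan] mult_eq_0_iff of_bool_eq_0_iff Ball_def
          lessThan_iff in_lang[symmetric] de_Morgan_conj not_not)
    have bound: "e < n + 1 \<and> i < n + 1" if "idx k e i = n" for k e i
      using le_tag[of e k i] le_tag(2)[of i k e] tag_le_idx[of k e i] that by simp
    show ?thesis
    proof
      assume "x \<in> fam n"
      then obtain k e i where "k < 4" "idx k e i = n" "x \<in> lang k e i" unfolding fam_def by blast
      then show "f [n, x] \<noteq> 0" using bound zero by blast
    next
      assume "f [n, x] \<noteq> 0"
      then show "x \<in> fam n" unfolding zero fam_def by blast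
    qed
  qed
  ultimately show ?thesis
    unfolding indexed_family_def using prim_semidecidable[of f] by simp
qed

section \<open>Recovering the index from the maximum; membership in PSD\<close>

lemma double_sum_single:
  fixes h :: "nat \<Rightarrow> nat \<Rightarrow> nat"
  assumes "a < n" "b < n" "\<And>e i. (e, i) \<noteq> (a, b) \<Longrightarrow> h e i = 0"
  shows "(\<Sum>e<n. \<Sum>i<n. h e i) = h a b"
proof -
  have "(\<Sum>e<n. \<Sum>i<n. h e i) = (\<Sum>e<n. if e = a then h a b else 0)"
  proof (rule sum.cong)
    fix e
    have "(\<Sum>i<n. h e i) = (\<Sum>i<n. if i = b then h e b else 0)"
      by (rule sum.cong) (use assms(3) in auto)
    then show "(\<Sum>i<n. h e i) = (if e = a then h a b else 0)" using assms by auto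
  qed simp
  then show ?thesis using assms(1) by simp
qed

text \<open>Again a bounded search; injectivity of \<open>elt\<close> leaves a single term, the
  wanted index.\<close>

lemma index_of_top:
  obtains f where "prim 1 f" "\<And>k e i. k < 4 \<Longrightarrow> f [elt k e i] = idx k e i"
proof -
  define f where "f xs = (\<Sum>e<xs ! 0 + 1. \<Sum>i<xs ! 0 + 1. \<Sum>k<4::nat.
    of_bool (elt k e i = xs ! 0) * idx k e i)" for xs :: "nat list"
  have n: "prim (Suc (Suc 1)) (\<lambda>zs. tl (tl zs) ! 0)"
    by (rule prim_tl[OF prim_tl[OF prim_nth]], simp)+
  have v: "prim (Suc (Suc 1)) hd" "prim (Suc (Suc 1)) (\<lambda>zs. hd (tl zs))"
    by (rule prim_hd) (rule prim_tl[OF prim_hd])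
  have "prim (Suc (Suc 1)) (\<lambda>zs. \<Sum>k<4::nat. of_bool (elt k (hd (tl zs)) (hd zs) = tl (tl zs) ! 0) *
      idx k (hd (tl zs)) (hd zs))"
    by (intro prim_sum_fixed prim_mult prim_eq prim_idx prim_elt n v)
  then have "prim 1 f"
    unfolding f_def by (intro prim_double_sum prim_add prim_nth prim_const) simp_all
  moreover have "f [elt k e i] = idx k e i" if k: "k < 4" for k e i
  proof -
    let ?y = "elt k e i"
    have "f [?y] = (\<Sum>l<4. of_bool (elt l e i = ?y) * idx l e i)"
      unfolding f_def
      by (subst double_sum_single[of e _ i])
        (use le_tag[of e k i] le_tag(2)[of i k e] tag_le_elt[of k e i] k in \<open>auto dest: elt_inject\<close>)
    also have "\<dots> = (\<Sum>l<4. if l = k then idx k e i else 0)"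
      by (rule sum.cong) (use k in \<open>auto dest: elt_inject\<close>)
    finally show ?thesis using k by simp
  qed
  ultimately show ?thesis using that by blast
qed

text \<open>Mapping the maximum seen so far to its index is correct and stable once the whole finite
  language has appeared. At most three elements occur, so the constant 4 is a strict bound.\<close>

lemma PSD_fam: "PSD fam"
proof -
  obtain f where f: "prim 1 f" "\<And>k e i. k < 4 \<Longrightarrow> f [elt k e i] = idx k e i"
    using index_of_top by blast
  obtain M where M: "\<And>xs. halts {} M xs" "\<And>xs. out_nat {} M xs = f [Max (insert 0 (set xs))]"
    using prim_of_max_learner[OF f(1)] by blast
  have "\<exists>n. card (set (pre g n)) < poly [:4::nat:] (mi fam A)
          \<and> (\<forall>j\<ge>n. halts {} M (pre g j) \<and> out_nat {} M (pre g j) = out_nat {} M (pre g n))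
          \<and> fam (out_nat {} M (pre g n)) = A"
    if A: "A \<in> range fam" and g: "is_enum A g" for A g
  proof -
    have "A \<noteq> {}" "range g = A" using g by (auto simp: is_enum_def)
    then obtain k e i where k: "k < 4" "A = lang k e i"
      using A fam_nonempty fam_idx by (metis imageE)
    have "finite (g ` UNIV)" using k finite_lang \<open>range g = A\<close> by simp
    then obtain N where N: "finite N" "g ` N = A"
      using finite_subset_image[of "g ` UNIV" g UNIV] \<open>range g = A\<close> by auto
    obtain n where n: "N \<subseteq> {..<n}" using finite_nat_iff_bounded N(1) by auto
    have set: "set (pre g j) = A" if "n \<le> j" for j
    proof -
      have "A \<subseteq> g ` {0..<j}" using N(2) n that by fastforce
      then show ?thesis using \<open>range g = A\<close> by (auto simp: pre_def)
    qed
    have out: "out_nat {} M (pre g j) = idx k e i" if "n \<le> j" for j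
    proof -
      have "Max (insert 0 A) = elt k e i"
        using Max_lang[of k e i] finite_lang lang_nonempty k(2) by (simp add: Max_insert)
      then show ?thesis using M(2) set[OF that] f(2)[OF k(1)] by simp
    qed
    have "card A \<le> 3"
      using card_insert_le_m1[of 3] unfolding k(2) lang_def
      by (auto simp: card_insert_if)
    then show ?thesis
      using out set M(1) fam_idx[OF k(1)] k(2) by (intro exI[of _ n]) simp
  qed
  then show ?thesis
    unfolding PSD_def
    by (intro conjI indexed_family_fam exI[of _ M] exI[of _ "[:4::nat:]"] ballI allI impI)
qed


section \<open>Numbers a program can form in a few steps\<close>

text \<open>\<open>L\<close> stands for the input length, \<open>C\<close> for a bound on input
  entries and program constants, \<open>u\<close> for the number of steps. An addition or
  subtraction at most doubles both coefficients. \<open>L\<close> is kept apart from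
  \<open>C\<close> because it may be far larger.\<close>

definition affine :: "nat \<Rightarrow> nat \<Rightarrow> nat \<Rightarrow> nat \<Rightarrow> bool" where
  "affine L C u v \<longleftrightarrow>
     (\<exists>\<alpha> \<gamma> :: int. int v = \<alpha> * int L + \<gamma> \<and> \<bar>\<alpha>\<bar> \<le> 2 ^ u \<and> \<bar>\<gamma>\<bar> \<le> 2 ^ u * int C)"

lemma affine_const: "v \<le> C \<Longrightarrow> affine L C u v"
proof -
  assume "v \<le> C"
  then have "int v * 1 \<le> int C * 2 ^ u" by (intro mult_mono) auto
  then show ?thesis unfolding affine_def
    by (intro exI[of _ 0] exI[of _ "int v"]) (simp add: mult.commute)
qed

lemma affine_length: "affine L C u L"
  unfolding affine_def by (rule exI[of _ 1], rule exI[of _ 0]) simp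

lemma affine_mono:
  assumes "affine L C u v" "u \<le> t"
  shows "affine L C t v"
proof -
  obtain \<alpha> \<gamma> :: int where *: "int v = \<alpha> * int L + \<gamma>" "\<bar>\<alpha>\<bar> \<le> 2 ^ u" "\<bar>\<gamma>\<bar> \<le> 2 ^ u * int C"
    using assms(1) unfolding affine_def by blast
  have "(2::int) ^ u \<le> 2 ^ t" using assms(2) by (intro power_increasing) auto
  then have "\<bar>\<alpha>\<bar> \<le> 2 ^ t" "\<bar>\<gamma>\<bar> \<le> 2 ^ t * int C"
    using *(2,3) mult_right_mono[of "2 ^ u" "2 ^ t" "int C"] by linarith+
  then show ?thesis unfolding affine_def using *(1) by blast
qed

lemma affine_add:
  assumes "affine L C u v" "affine L C u w"
  shows "affine L C (Suc u) (v + w)"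
proof -
  obtain \<alpha> \<gamma> \<alpha>' \<gamma>' :: int where
    *: "int v = \<alpha> * int L + \<gamma>" "\<bar>\<alpha>\<bar> \<le> 2 ^ u" "\<bar>\<gamma>\<bar> \<le> 2 ^ u * int C"
       "int w = \<alpha>' * int L + \<gamma>'" "\<bar>\<alpha>'\<bar> \<le> 2 ^ u" "\<bar>\<gamma>'\<bar> \<le> 2 ^ u * int C"
    using assms unfolding affine_def by blast
  have "int (v + w) = (\<alpha> + \<alpha>') * int L + (\<gamma> + \<gamma>')" using * by (simp add: algebra_simps)
  moreover have "\<bar>\<alpha> + \<alpha>'\<bar> \<le> 2 ^ Suc u" using * by simp
  moreover have "\<bar>\<gamma> + \<gamma>'\<bar> \<le> 2 ^ Suc u * int C" using *(3,6) by simp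
  ultimately show ?thesis unfolding affine_def by blast
qed

lemma affine_diff:
  assumes "affine L C u v" "affine L C u w"
  shows "affine L C (Suc u) (v - w)"
proof (cases "w \<le> v")
  case True
  obtain \<alpha> \<gamma> \<alpha>' \<gamma>' :: int where
    *: "int v = \<alpha> * int L + \<gamma>" "\<bar>\<alpha>\<bar> \<le> 2 ^ u" "\<bar>\<gamma>\<bar> \<le> 2 ^ u * int C"
       "int w = \<alpha>' * int L + \<gamma>'" "\<bar>\<alpha>'\<bar> \<le> 2 ^ u" "\<bar>\<gamma>'\<bar> \<le> 2 ^ u * int C"
    using assms unfolding affine_def by blast
  have "int (v - w) = (\<alpha> - \<alpha>') * int L + (\<gamma> - \<gamma>')" using * True by (simp add: algebra_simps of_nat_diff)
  moreover have "\<bar>\<alpha> - \<alpha>'\<bar> \<le> 2 ^ Suc u" using * by simp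
  moreover have "\<bar>\<gamma> - \<gamma>'\<bar> \<le> 2 ^ Suc u * int C" using *(3,6) by simp
  ultimately show ?thesis unfolding affine_def by blast
qed (simp add: affine_const)

text \<open>The oracle is arbitrary: its answers 0 and 1 are at most \<open>C\<close>. Queried
  numbers are register contents, so they obey the same bound.\<close>

lemma run_affine:
  assumes "\<forall>x\<in>set xs. x \<le> C" "\<And>r c. Const r c \<in> set M \<Longrightarrow> c \<le> C" "1 \<le> C"
  shows "(\<forall>r. affine (length xs) C u (fst (snd (run Or M xs u)) r)) \<and>
    (\<forall>q\<in>fst ` set (snd (snd (run Or M xs u))). affine (length xs) C u q)"
proof (induction u)
  case 0
  have "affine (length xs) C 0 (if i = 0 then length xs else if i \<le> length xs then xs ! (i - 1) else 0)" for i
  proof -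
    have "xs ! (i - 1) \<le> C" if "i \<noteq> 0" "i \<le> length xs"
      using that assms(1) by (simp add: Suc_le_eq)
    then show ?thesis by (simp add: affine_length affine_const)
  qed
  then show ?case by (simp add: run_def init_def)
next
  case (Suc u)
  let ?a = "affine (length xs) C"
  obtain pc m qs where r: "run Or M xs u = (pc, m, qs)" by (cases "run Or M xs u") auto
  have m: "?a u (m r)" for r using Suc r by simp
  have m': "?a (Suc u) (m r)" for r by (rule affine_mono[OF m]) simp
  have q': "?a (Suc u) q" if "q \<in> fst ` set qs" for q
    by (rule affine_mono[of _ _ u]) (use Suc r that in auto)
  show ?case
  proof (cases "halted M pc")
    case True
    then have "run Or M xs (Suc u) = (pc, m, qs)" by (simp add: run_Suc r step_def)
    then show ?thesis using m' q' by simp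
  next
    case False
    then have "M ! pc \<in> set M" by (simp add: halted_def)
    then have c: "?a (Suc u) c" if "M ! pc = Const r c" for r c
      using assms(2)[of r c] that affine_const by simp
    have b: "?a (Suc u) (if P then 1 else 0)" for P using assms(3) by (auto intro: affine_const)
    have e: "run Or M xs (Suc u) = exec Or (M ! pc) (pc, m, qs)"
      using False by (simp add: run_Suc r step_def)
    have upd: "?a (Suc u) ((m(r := v)) r')" if "?a (Suc u) v" for r r' v
      using that m' by simp
    show ?thesis
    proof (cases "M ! pc")
      case (Const r v)
      then show ?thesis unfolding e using upd c q' by simp
    next
      case (Add r v w)
      then show ?thesis unfolding e using upd affine_add[OF m m] q' by simp
    next
      case (Sub r v w)
      then show ?thesis unfolding e using upd affine_diff[OF m m] q' by simp
    next
      case (Load r v)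
      then show ?thesis unfolding e using upd m' q' by simp
    next
      case (Store v w)
      then show ?thesis unfolding e using upd m' q' by simp
    next
      case (Jz r l)
      then show ?thesis unfolding e using m' q' by simp
    next
      case (Query r v)
      then show ?thesis unfolding e using upd[OF b] m' q' by (simp add: image_Un)
    next
      case Halt
      then show ?thesis unfolding e using m' q' by simp
    qed
  qed
qed

text \<open>Integrality of \<alpha> gives the dichotomy: if it is not positive, the length cannot
  help to make \<open>v\<close> large; otherwise it is at least 1 and \<open>v\<close> is nearly as
  large as \<open>L\<close> or larger.\<close>

lemma affine_cases:
  assumes "affine L C u v"
  shows "v \<le> 2 ^ u * C \<or> (L \<le> v + 2 ^ u * C \<and> v \<le> 2 ^ u * (L + C))"
proof -
  obtain \<alpha> \<gamma> :: int where *: "int v = \<alpha> * int L + \<gamma>" "\<bar>\<alpha>\<bar> \<le> 2 ^ u" "\<bar>\<gamma>\<bar> \<le> 2 ^ u * int C"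
    using assms unfolding affine_def by blast
  show ?thesis
  proof (cases "\<alpha> \<le> 0")
    case True
    then have "\<alpha> * int L \<le> 0" by (simp add: mult_nonpos_nonneg)
    then have "int v \<le> 2 ^ u * int C" using * by linarith
    then have "int v \<le> int (2 ^ u * C)" by simp
    then show ?thesis using of_nat_le_iff by blast
  next
    case False
    then have "1 * int L \<le> \<alpha> * int L" "\<alpha> * int L \<le> 2 ^ u * int L"
      using *(2) by (intro mult_right_mono; simp)+
    then have "int L \<le> int v + 2 ^ u * int C" "int v \<le> 2 ^ u * int L + 2 ^ u * int C" using * by linarith+
    then have "int L \<le> int (v + 2 ^ u * C)" "int v \<le> int (2 ^ u * (L + C))"
      by (simp_all add: distrib_left)
    then show ?thesis using of_nat_le_iff by blast
  qed
qed

section \<open>Runs under different oracles\<close>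

definition queried :: "nat set \<Rightarrow> prog \<Rightarrow> nat list \<Rightarrow> nat \<Rightarrow> nat set" where
  "queried Or M s t = fst ` set (snd (snd (run Or M s t)))"

text \<open>Only the run with oracle \<open>B\<close> is inspected; by \<open>run_agree\<close> the
  run with \<open>A\<close> is then the same.\<close>

definition quiet :: "nat set \<Rightarrow> nat set \<Rightarrow> prog \<Rightarrow> nat \<Rightarrow> nat list \<Rightarrow> bool" where
  "quiet A B M t s \<longleftrightarrow> (\<forall>q\<in>queried B M s t. q \<in> A \<longleftrightarrow> q \<in> B)"

lemma queries_step:
  "\<exists>l. snd (snd (step Or M c)) = snd (snd c) @ l \<and> length l \<le> 1"
proof (cases c)
  case (fields pc m qs)
  then show ?thesis
    by (cases "halted M pc"; cases "M ! pc") (simp_all add: step_def)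
qed

lemma queried_Suc: "queried Or M s t \<subseteq> queried Or M s (Suc t)"
  using queries_step[of Or M "run Or M s t"] by (auto simp: queried_def run_Suc)

lemma queried_mono: "t \<le> u \<Longrightarrow> queried Or M s t \<subseteq> queried Or M s u"
  using lift_Suc_mono_le[of "queried Or M s", OF queried_Suc] by blast

lemma quiet_mono: "quiet A B M u s \<Longrightarrow> t \<le> u \<Longrightarrow> quiet A B M t s"
  using queried_mono unfolding quiet_def by blast

lemma length_queries_le: "length (snd (snd (run Or M s t))) \<le> t"
proof (induction t)
  case 0
  then show ?case by (simp add: run_def init_def)
next
  case (Suc t)
  then show ?case using queries_step[of Or M "run Or M s t"] by (auto simp: run_Suc)
qed

lemma card_queried_le: "card (queried Or M s t) \<le> t"
  unfolding queried_def
  using card_image_le[of "set (snd (snd (run Or M s t)))" fst] card_length[of "snd (snd (run Or M s t))"]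
    length_queries_le[of Or M s t] by simp

lemma queried_halted:
  assumes "halts Or M s" "steps Or M s \<le> t"
  shows "queried Or M s t = queried Or M s (steps Or M s)"
  unfolding queried_def using run_halted[OF halted_steps[OF assms(1)] assms(2)] by simp

lemma run_agree:
  assumes "quiet A B M t s"
  shows "run A M s t = run B M s t"
  using assms
proof (induction t)
  case 0
  then show ?case by (simp add: run_def)
next
  case (Suc t)
  then have eq: "run A M s t = run B M s t" using quiet_mono by (metis le_add2 plus_1_eq_Suc)
  obtain pc m qs where r: "run B M s t = (pc, m, qs)" by (cases "run B M s t") auto
  show ?case
  proof (cases "\<not> halted M pc \<and> (\<exists>r a. M ! pc = Query r a)")
    case True
    then obtain a b where q: "M ! pc = Query b a" "\<not> halted M pc" by blast
    then have "m a \<in> queried B M s (Suc t)" by (simp add: queried_def run_Suc r step_def)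
    then have "m a \<in> A \<longleftrightarrow> m a \<in> B" using Suc.prems unfolding quiet_def by blast
    then show ?thesis using q by (simp add: run_Suc eq r step_def)
  next
    case False
    then show ?thesis by (cases "M ! pc") (auto simp: run_Suc eq r step_def)
  qed
qed

lemma halts_cong_run:
  assumes "\<And>u. u \<le> t \<Longrightarrow> run A M s u = run B M s u" "halts A M s" "steps A M s \<le> t"
  shows "halts B M s \<and> steps B M s = steps A M s"
proof -
  have h: "halted M (fst (run B M s (steps A M s)))"
    using halted_steps[OF assms(2)] assms(1,3) by simp
  then have B: "halts B M s" unfolding halts_def by blast
  have le: "steps B M s \<le> steps A M s" using steps_le[OF h] .
  then have "halted M (fst (run A M s (steps B M s)))"
    using halted_steps[OF B] assms(1,3) by simp
  then have "steps A M s \<le> steps B M s" by (rule steps_le)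
  then show ?thesis using B le by simp
qed

lemma halts_agree:
  assumes "quiet A B M t s" "halts A M s \<and> steps A M s \<le> t \<or> halts B M s \<and> steps B M s \<le> t"
  shows "halts A M s" "halts B M s" "steps A M s = steps B M s" "steps B M s \<le> t"
    "out_nat A M s = out_nat B M s" "queries A M s = queries B M s"
proof -
  have eq: "run A M s u = run B M s u" if "u \<le> t" for u
    using run_agree quiet_mono[OF assms(1) that] by blast
  have "halts A M s \<and> halts B M s \<and> steps A M s = steps B M s \<and> steps B M s \<le> t"
    using assms(2)
  proof
    assume "halts A M s \<and> steps A M s \<le> t"
    then show ?thesis using halts_cong_run[of t A M s B] eq by auto
  next
    assume "halts B M s \<and> steps B M s \<le> t"
    then show ?thesis using halts_cong_run[of t B M s A] eq by auto
  qed
  then show "halts A M s" "halts B M s" "steps A M s = steps B M s" "steps B M s \<le> t"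
    "out_nat A M s = out_nat B M s" "queries A M s = queries B M s"
    using eq by (auto simp: out_nat_def final_mem_def queries_def)
qed

section \<open>Rounds of teacher and learner under two oracles\<close>

lemma pre_cong: "(\<And>j. j < n \<Longrightarrow> f j = g j) \<Longrightarrow> pre f n = pre g n"
  by (simp add: pre_def)

text \<open>The teacher sees the transcript, so equal data do not suffice: the answers must agree
  round by round. Halting within \<open>t\<close>, known on either side, ensures that
  \<open>quiet\<close> covers all queries of a round.\<close>

lemma transcript_agree:
  assumes "\<And>j. j < r \<Longrightarrow> f j = g j"
    and "\<And>j. j < r \<Longrightarrow> quiet A B M t (tout M T B g j)"
    and "\<And>j. j < r \<Longrightarrow> halts A M (tout M T A f j) \<and> steps A M (tout M T A f j) \<le> t \<or>
       halts B M (tout M T B g j) \<and> steps B M (tout M T B g j) \<le> t"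
    and "j \<le> r"
  shows "transcript M T A f j = transcript M T B g j"
  using assms(4)
proof (induction j)
  case (Suc j)
  have p: "pre f j = pre g j" using Suc.prems assms(1) by (intro pre_cong) simp
  have tr: "transcript M T A f j = transcript M T B g j" using Suc by simp
  then have to: "tout M T A f j = tout M T B g j" by (simp add: tout_def p)
  have "queries A M (tout M T B g j) = queries B M (tout M T B g j)"
    by (rule halts_agree(6)[of A B M t]) (use assms(2,3)[of j] Suc.prems to in auto)
  then show ?case by (simp add: tr p tout_def)
qed simp

lemma tout_agree:
  assumes "\<And>j. j < r \<Longrightarrow> f j = g j"
    and "\<And>j. j < r \<Longrightarrow> quiet A B M t (tout M T B g j)"
    and "\<And>j. j < r \<Longrightarrow> halts A M (tout M T A f j) \<and> steps A M (tout M T A f j) \<le> t \<or>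
       halts B M (tout M T B g j) \<and> steps B M (tout M T B g j) \<le> t"
    and "j \<le> r"
  shows "tout M T A f j = tout M T B g j"
  unfolding tout_def using transcript_agree[OF assms] pre_cong[of j f g] assms(1,4) by simp

text \<open>Success in the sense of \<open>PRT_TO\<close> at a given \<open>n\<close>, with a number
  \<open>t\<close> as time bound. Steps are summed over the set of messages, so a repeated message
  is paid once.\<close>

definition converges :: "(nat \<Rightarrow> nat set) \<Rightarrow> prog \<Rightarrow> prog \<Rightarrow> nat \<Rightarrow> nat set \<Rightarrow> (nat \<Rightarrow> nat) \<Rightarrow> nat \<Rightarrow> bool" where
  "converges F M T t A f n \<longleftrightarrow>
     (\<forall>j\<le>n. halts A M (tout M T A f j)) \<and>
     (\<forall>j\<ge>n. halts A M (tout M T A f j) \<and>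
        out_nat A M (tout M T A f j) = out_nat A M (tout M T A f n)) \<and>
     F (out_nat A M (tout M T A f n)) = A \<and>
     (\<Sum>s\<in>tout M T A f ` {..n}. steps A M s) < t"

lemma converges_steps:
  assumes "converges F M T t A f n" "j \<le> n"
  shows "halts A M (tout M T A f j)" "steps A M (tout M T A f j) \<le> t"
proof -
  have "steps A M (tout M T A f j) \<le> (\<Sum>s\<in>tout M T A f ` {..n}. steps A M s)"
    using assms(2) by (intro member_le_sum) auto
  then show "steps A M (tout M T A f j) \<le> t" using assms(1) unfolding converges_def by simp
  show "halts A M (tout M T A f j)" using assms unfolding converges_def by simp
qed

text \<open>Up to the convergence point \<open>n\<close> the rounds on \<open>A\<close> are paid for
  by \<open>t\<close>, and the quiet rounds on \<open>B\<close> are identical to them.\<close>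

lemma converges_late_transfer:
  assumes c: "converges F M T t A f n" and r: "r \<le> Suc n"
    and fg: "\<And>j. j < r \<Longrightarrow> f j = g j"
    and q: "\<And>j. j < r \<Longrightarrow> quiet A B M t (tout M T B g j)"
  shows "\<And>j. j < r \<Longrightarrow> tout M T A f j = tout M T B g j"
    and "\<And>j. j < r \<Longrightarrow> halts B M (tout M T B g j) \<and> steps B M (tout M T B g j) \<le> t"
    and "(\<Sum>s\<in>tout M T B g ` {..<r}. steps B M s) < t"
proof -
  have h: "halts A M (tout M T A f j) \<and> steps A M (tout M T A f j) \<le> t" if "j < r" for j
    using converges_steps[OF c, of j] that r by simp
  show to: "tout M T A f j = tout M T B g j" if "j < r" for j
    using tout_agree[of r f g A B M t T j] fg q h that by auto
  have hs: "halts B M (tout M T B g j) \<and> steps B M (tout M T B g j) \<le> t \<and>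
      steps A M (tout M T B g j) = steps B M (tout M T B g j)" if "j < r" for j
    using halts_agree[OF q[OF that]] h[OF that] to[OF that] by auto
  then show "halts B M (tout M T B g j) \<and> steps B M (tout M T B g j) \<le> t" if "j < r" for j
    using that by blast
  have im: "tout M T B g ` {..<r} = tout M T A f ` {..<r}" using to by (intro image_cong) auto
  have "(\<Sum>s\<in>tout M T B g ` {..<r}. steps B M s) = (\<Sum>s\<in>tout M T A f ` {..<r}. steps A M s)"
    unfolding im by (rule sum.cong) (use hs to in auto)
  also have "\<dots> \<le> (\<Sum>s\<in>tout M T A f ` {..n}. steps A M s)"
    using r by (intro sum_mono2) auto
  also have "\<dots> < t" using c unfolding converges_def by simp
  finally show "(\<Sum>s\<in>tout M T B g ` {..<r}. steps B M s) < t" .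
qed

text \<open>As long as the learner working on \<open>B\<close> has not separated \<open>A\<close> from \<open>A'\<close> by a query, it
  cannot have converged on both, so it is still paying for its steps on one of them.\<close>

lemma unseparated_is_fast:
  assumes c: "converges F M T t A f n" "converges F M T t A' f' n'" and "A \<noteq> A'"
    and fg: "\<And>j. j < r \<Longrightarrow> f j = g j" "\<And>j. j < r \<Longrightarrow> f' j = g j"
    and q: "\<And>j. j < r \<Longrightarrow> quiet A B M t (tout M T B g j)"
      "\<And>j. j < r \<Longrightarrow> quiet A' B M t (tout M T B g j)"
  shows "(\<forall>j<r. halts B M (tout M T B g j)) \<and> (\<Sum>s\<in>tout M T B g ` {..<r}. steps B M s) < t"
proof -
  \<comment> \<open>If both convergence points precede \<open>r\<close>, then in the later of the
    two rounds both runs coincide with the run on \<open>B\<close> and output the same hypothesis,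
    which cannot denote two sets.\<close>
  have clash: False if c: "converges F M T t A f n" "converges F M T t A' f' n'" and "A \<noteq> A'"
    and fg: "\<And>j. j < r \<Longrightarrow> f j = g j" "\<And>j. j < r \<Longrightarrow> f' j = g j"
    and q: "\<And>j. j < r \<Longrightarrow> quiet A B M t (tout M T B g j)"
      "\<And>j. j < r \<Longrightarrow> quiet A' B M t (tout M T B g j)"
    and n: "n \<le> n'" "n' < r" for A A' f f' n n'
  proof -
    have fg': "\<And>j. j < Suc n' \<Longrightarrow> f j = g j" "\<And>j. j < Suc n' \<Longrightarrow> f' j = g j"
      and q': "\<And>j. j < Suc n' \<Longrightarrow> quiet A B M t (tout M T B g j)"
        "\<And>j. j < Suc n' \<Longrightarrow> quiet A' B M t (tout M T B g j)"
      using fg q n by auto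
    note B = converges_late_transfer[OF c(2) order_refl fg'(2) q'(2)]
    have A: "tout M T A f n' = tout M T B g n'"
      using tout_agree[of "Suc n'" f g A B M t T n'] fg'(1) q'(1) B(2) by simp
    have "out_nat A M (tout M T A f n') = out_nat B M (tout M T B g n')"
      unfolding A using halts_agree(5)[OF q'(1)] B(2) by simp
    also have "\<dots> = out_nat A' M (tout M T A' f' n')"
      using halts_agree(5)[OF q'(2)] B(1,2) by simp
    finally have "out_nat A M (tout M T A f n) = out_nat A' M (tout M T A' f' n')"
      using c(1) n(1) unfolding converges_def by metis
    then show False using c \<open>A \<noteq> A'\<close> unfolding converges_def by metis
  qed
  \<comment> \<open>Without a clash, \<open>r\<close> is at most one past a convergence point, and
    that time bound carries over.\<close>
  consider "r \<le> Suc n" | "r \<le> Suc n'" | "n \<le> n'" "n' < r" | "n' \<le> n" "n < r" by linarith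
  then show ?thesis
  proof cases
    case 1
    show ?thesis using converges_late_transfer[OF c(1) 1 fg(1) q(1)] by blast
  next
    case 2
    show ?thesis using converges_late_transfer[OF c(2) 2 fg(2) q(2)] by blast
  next
    case 3
    then show ?thesis using clash[OF c \<open>A \<noteq> A'\<close> fg q] by blast
  next
    case 4
    then show ?thesis using clash[OF c(2,1) \<open>A \<noteq> A'\<close>[symmetric] fg(2,1) q(2,1)] by blast
  qed
qed


section \<open>The lower bound\<close>

lemma poly_nat_mono:
  fixes x y :: nat
  assumes "x \<le> y"
  shows "poly p x \<le> poly p y"
  using assms by (induction p) (auto intro: mult_le_mono)

lemma poly_nat_bound: "\<exists>K d. \<forall>x::nat. poly p x \<le> K * (x + 1) ^ d"
proof (induction p)
  case 0
  then show ?case by (intro exI[of _ 0]) simp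
next
  case (pCons a p)
  then obtain K d where K: "poly p x \<le> K * (x + 1) ^ d" for x by blast
  have "poly (pCons a p) x \<le> (a + K) * (x + 1) ^ Suc d" for x
  proof -
    have "poly (pCons a p) x = a * 1 + x * poly p x" by simp
    also have "\<dots> \<le> a * (x + 1) ^ Suc d + (x + 1) * (K * (x + 1) ^ d)"
      by (intro add_le_mono mult_le_mono K one_le_power) auto
    also have "\<dots> = (a + K) * (x + 1) ^ Suc d" by (simp only: power_Suc distrib_right mult.left_commute)
    finally show ?thesis .
  qed
  then show ?case by blast
qed

text \<open>Restricting to \<open>e = 2 ^ j\<close> turns the claim into a comparison of exponents,
  a quadratic in \<open>j\<close> against \<open>2 ^ j\<close>.\<close>

lemma poly_nat_less_power: "\<exists>e::nat. poly p e < 2 ^ e"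
proof -
  obtain K d where K: "\<And>x. poly p x \<le> K * (x + 1) ^ d" using poly_nat_bound by blast
  have sq: "(u + 1) * u < 2 ^ u" if "5 \<le> u" for u :: nat
    using that
  proof (induction rule: dec_induct)
    case (step u)
    then have "u + 2 \<le> u * u" using mult_le_mono1[of 5 u u] by linarith
    with step have "(Suc u + 1) * Suc u \<le> 2 * ((u + 1) * u)" by (simp add: algebra_simps)
    then show ?case using step by simp
  qed simp
  define j where "j = d + K + 5"
  let ?e = "2 ^ j :: nat"
  have "(?e + 1) ^ d \<le> (2 ^ (j + 1)) ^ d" by (intro power_mono) auto
  then have "poly p ?e \<le> K * (2 ^ (j + 1)) ^ d" using K[of ?e] by (meson le_trans mult_le_mono2)
  also have "\<dots> \<le> 2 ^ K * (2 ^ (j + 1)) ^ d" using less_exp[of K] by (intro mult_le_mono1) simp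
  also have "\<dots> = 2 ^ (K + (j + 1) * d)" by (simp add: power_add power_mult)
  also have "\<dots> < 2 ^ ?e"
  proof (rule power_strict_increasing)
    have "K + (j + 1) * d \<le> (j + 1) * (d + K)" by (simp add: algebra_simps)
    also have "\<dots> \<le> (j + 1) * j" by (intro mult_le_mono2) (simp add: j_def)
    also have "\<dots> < ?e" by (rule sq) (simp add: j_def)
    finally show "K + (j + 1) * d < ?e" .
  qed simp
  finally show ?thesis by blast
qed

text \<open>With \<open>D = 2 ^ E\<close>, \<open>E\<close> steps on a message of length about
  \<open>D ^ m\<close> cannot form a number as large as \<open>D ^ (m + 2)\<close>.\<close>

lemma power_gap:
  fixes D L :: nat
  assumes "4 \<le> D" "1 \<le> m" "m + 2 \<le> n" "L \<le> 2 * D ^ m"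
  shows "D * (L + D) < D ^ n"
proof -
  have "D ^ 1 \<le> D ^ m" using assms(1,2) by (intro power_increasing) auto
  then have "D * (L + D) \<le> D * (3 * D ^ m)" using assms(4) by (intro mult_le_mono2) simp
  also have "\<dots> < D * (D * D ^ m)" using assms(1) by simp
  also have "\<dots> = D ^ (m + 2)" by simp
  also have "\<dots> \<le> D ^ n" using assms(1,3) by (intro power_increasing) auto
  finally show ?thesis .
qed

lemma tag_mono: "k \<le> 3 \<Longrightarrow> i \<le> j \<Longrightarrow> tag k e i \<le> tag 3 e j"
  unfolding tag_def by (intro add_le_mono mult_le_mono) auto

definition window :: "nat \<Rightarrow> nat \<Rightarrow> nat set" where
  "window e i = {elt 1 e i, elt 2 e i, elt 3 e i}"

lemma window_disjoint: "x \<in> window e i \<Longrightarrow> x \<in> window e j \<Longrightarrow> i = j"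
  unfolding window_def by (auto dest: elt_inject)

text \<open>Data seen so far remain compatible with every language containing them.\<close>

lemma extend_enum:
  fixes A :: "nat set"
  assumes "A \<noteq> {}" "\<And>j. j < r \<Longrightarrow> g j \<in> A"
  shows "\<exists>f. is_enum A f \<and> (\<forall>j<r. f j = g j)"
proof (intro exI conjI)
  let ?f = "\<lambda>j. if j < r then g j else from_nat_into A (j - r)"
  show "\<forall>j<r. ?f j = g j" by simp
  have "from_nat_into A ` UNIV \<subseteq> range ?f"
  proof
    fix x assume "x \<in> from_nat_into A ` UNIV"
    then obtain k where "x = from_nat_into A k" by blast
    then have "x = ?f (r + k)" by simp
    then show "x \<in> range ?f" by blast
  qed
  moreover have "range ?f \<subseteq> A" using assms from_nat_into[OF assms(1)] by auto
  ultimately show "is_enum A ?f"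
    using range_from_nat_into[OF assms(1)] assms(1) unfolding is_enum_def by auto
qed

section \<open>A hypothetical learner and teacher for the family, refuted\<close>

locale oracle_learner =
  fixes M T :: prog and p :: "nat poly"
  assumes succeeds: "\<forall>A\<in>range fam. \<forall>f. is_enum A f \<longrightarrow>
       (\<forall>j. halts {} T (teach_in (pre f j) (transcript M T A f j)))
     \<and> (\<forall>j k. j \<le> k \<longrightarrow> (\<exists>u. tout M T A f k = tout M T A f j @ u))
     \<and> (\<forall>j. set (tout M T A f j) \<subseteq> set (pre f j))
     \<and> (\<exists>n. (\<forall>j\<le>n. halts A M (tout M T A f j))
          \<and> (\<forall>j\<ge>n. halts A M (tout M T A f j)
                   \<and> out_nat A M (tout M T A f j) = out_nat A M (tout M T A f n))
          \<and> fam (out_nat A M (tout M T A f n)) = A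
          \<and> (\<Sum>s\<in>tout M T A f ` {..n}. steps A M s) < poly p (mi fam A)
          \<and> (\<Sum>s\<in>tout M T A f ` {..n}. length (queries A M s)) \<le> poly p (mi fam A))"
begin

lemmas learns = succeeds[THEN bspec, THEN spec, THEN mp, THEN conjunct2]
lemmas tout_prefix = learns[THEN conjunct1, THEN spec, THEN spec, THEN mp]
lemmas tout_content = learns[THEN conjunct2, THEN conjunct1, THEN spec]
lemmas success = learns[THEN conjunct2, THEN conjunct2]

lemma lang_in_range: "k < 4 \<Longrightarrow> lang k e i \<in> range fam"
  using fam_idx by (metis rangeI)

lemma tout_length_mono:
  assumes "k < 4" "is_enum (lang k e i) f" "j \<le> j'"
  shows "length (tout M T (lang k e i) f j) \<le> length (tout M T (lang k e i) f j')"
  using tout_prefix[OF lang_in_range[OF assms(1)] assms(2,3)] by (elim exE) simp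

lemma tout_set:
  assumes "k < 4" "is_enum (lang k e i) f"
  shows "set (tout M T (lang k e i) f j) \<subseteq> lang k e i"
proof -
  have "set (tout M T (lang k e i) f j) \<subseteq> set (pre f j)"
    by (rule tout_content[OF lang_in_range[OF assms(1)] assms(2)])
  also have "\<dots> \<subseteq> range f" by (auto simp: pre_def)
  finally show ?thesis using assms(2) by (simp add: is_enum_def)
qed

lemma lang_converges:
  assumes "k < 4" "is_enum (lang k e i) f" "poly p (idx k e i) \<le> t"
  obtains n where "converges fam M T t (lang k e i) f n"
proof -
  have "mi fam (lang k e i) \<le> idx k e i"
    unfolding mi_def by (rule Least_le) (rule fam_idx[OF assms(1)])
  then have "poly p (mi fam (lang k e i)) \<le> t" using poly_nat_mono assms(3) le_trans by blast
  with success[OF lang_in_range[OF assms(1)] assms(2)] show ?thesis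
    by (elim exE conjE)
      (rule that, unfold converges_def, intro conjI; (assumption | rule less_le_trans; assumption))
qed

lemma lang_2_neq_3: "lang 2 e i \<noteq> lang 3 e i"
proof
  assume "lang 2 e i = lang 3 e i"
  then have "elt 2 e i = elt 3 e i" by (metis Max_lang)
  then show False using elt_inject[of 2 e i 3 e i] by simp
qed

text \<open>The data extend to enumerations of both triples, whose indices are mere tags. Until a
  query separates the triples, the learner is therefore bound by the time limit for them, whatever
  \<open>B\<close> is.\<close>

lemma unqueried_is_fast:
  assumes t: "poly p (tag 3 e i) \<le> t"
    and g: "\<And>j. j < r \<Longrightarrow> g j \<in> {elt 0 e 0, elt 1 e i}"
    and q: "\<And>j k. j < r \<Longrightarrow> k \<in> {2, 3} \<Longrightarrow> quiet (lang k e i) B M t (tout M T B g j)"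
  shows "(\<forall>j<r. halts B M (tout M T B g j)) \<and> (\<Sum>s\<in>tout M T B g ` {..<r}. steps B M s) < t"
proof -
  have ex: "\<exists>f n. converges fam M T t (lang k e i) f n \<and> (\<forall>j<r. f j = g j)" if k: "k \<in> {2, 3}" for k
  proof -
    have k4: "k < 4" using k by auto
    have gm: "g j \<in> lang k e i" if "j < r" for j using g[OF that] k by (auto simp: lang_def)
    obtain f where f: "is_enum (lang k e i) f" "\<forall>j<r. f j = g j"
      using extend_enum[of "lang k e i" r g, OF lang_nonempty gm] by blast
    have "idx k e i = tag k e i" using k by (auto simp: idx_def)
    then have "poly p (idx k e i) \<le> t"
      using t poly_nat_mono[of "tag k e i" "tag 3 e i" p] tag_mono[of k i i e] k by auto
    then obtain n where "converges fam M T t (lang k e i) f n" using lang_converges[OF k4 f(1)] by blast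
    then show ?thesis using f(2) by blast
  qed
  obtain f n f' n' where
    "converges fam M T t (lang 2 e i) f n" "\<forall>j<r. f j = g j"
    "converges fam M T t (lang 3 e i) f' n'" "\<forall>j<r. f' j = g j"
    using ex[of 2] ex[of 3] by blast
  then show ?thesis
    using unseparated_is_fast[of fam M T t "lang 2 e i" f n "lang 3 e i" f' n' r g B] lang_2_neq_3 q by simp
qed

text \<open>Taking \<open>t\<close> to be \<open>poly p (tag 3 e 0)\<close>, all quantities to be
  dominated are polynomial in \<open>e\<close> or constant, so one large \<open>e\<close> serves for
  all.\<close>

lemma scale_exists:
  obtains e t where "poly p (tag 3 e 0) \<le> t" "t < 2 ^ e" "tag 3 e t \<le> 2 ^ e"
    "poly p (tag 3 e t) \<le> 2 ^ e" "\<And>r c. Const r c \<in> set M \<Longrightarrow> c \<le> 2 ^ e" "1 \<le> e"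
proof -
  define C where "C = sum_list (map (\<lambda>x. case x of Const r c \<Rightarrow> c | _ \<Rightarrow> 0) M)"
  have C: "c \<le> C" if "Const r c \<in> set M" for r c
  proof -
    have "c \<in> set (map (\<lambda>x. case x of Const r c \<Rightarrow> c | _ \<Rightarrow> 0) M)"
      using that by (force intro: image_eqI[of _ _ "Const r c"])
    then show ?thesis unfolding C_def by (rule member_le_sum_list) simp
  qed
  define x :: "nat poly" where "x = [:0, 1:]"
  define tagp where "tagp v = [:8:] * ((x + v) * (x + v) + v) + [:7:]" for v
  have tagp: "poly (tagp v) e = tag 3 e (poly v e)" for v e
    by (simp add: tagp_def tag_def x_def)
  define tp where "tp = pcompose p (tagp 0)"
  have tp: "poly tp e = poly p (tag 3 e 0)" for e by (simp add: tp_def poly_pcompose tagp)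
  define q where "q = [:C + 1:] + tp + tagp tp + pcompose p (tagp tp)"
  have q: "poly q e = C + 1 + poly p (tag 3 e 0) + tag 3 e (poly p (tag 3 e 0)) +
      poly p (tag 3 e (poly p (tag 3 e 0)))" for e
    by (simp add: q_def poly_pcompose tp tagp)
  obtain e where "poly q e < 2 ^ e" using poly_nat_less_power by blast
  then have e: "C + 1 + poly p (tag 3 e 0) + tag 3 e (poly p (tag 3 e 0)) +
      poly p (tag 3 e (poly p (tag 3 e 0))) < 2 ^ e" by (simp only: q)
  have "1 \<le> e"
  proof (rule ccontr)
    assume "\<not> 1 \<le> e"
    then have "e = 0" by simp
    then show False using e by simp
  qed
  moreover have "c \<le> 2 ^ e" if "Const r c \<in> set M" for r c
    using C[OF that] e by linarith
  ultimately show ?thesis using e by (intro that[of e "poly p (tag 3 e 0)"]) auto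
qed

lemma no_success: False
proof -
  obtain e t where t: "poly p (tag 3 e 0) \<le> t" "t < 2 ^ e" "tag 3 e t \<le> 2 ^ e"
    "poly p (tag 3 e t) \<le> 2 ^ e" and M_consts: "\<And>r c. Const r c \<in> set M \<Longrightarrow> c \<le> 2 ^ e" and e: "1 \<le> e"
    using scale_exists by blast
  \<comment> \<open>\<open>E\<close> will bound running times, and \<open>D\<close> is the factor by
    which \<open>E\<close> steps can enlarge coefficients.\<close>
  define E :: nat where "E = 2 ^ e"
  define D :: nat where "D = 2 ^ E"
  have E2: "2 \<le> E" unfolding E_def using e power_increasing[of 1 e "2::nat"] by simp
  have D4: "4 \<le> D" unfolding D_def using power_increasing[of 2 E "2::nat"] E2 by simp
  have ED: "E \<le> D" unfolding D_def by (simp add: less_exp less_imp_le)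
  have pw: "2 ^ (E * k) = D ^ k" for k by (simp add: D_def power_mult)
  have tag: "1 \<le> tag k e i" "tag k e i \<le> E" if "k \<le> 3" "i \<le> t" for k i
    using tag_mono[OF that, of e] t(3) by (simp_all add: tag_def E_def)
  \<comment> \<open>Tags are at most \<open>E <= D\<close>, so they raise an exponent of
    \<open>D\<close> by at most 1.\<close>
  have scaled: "D ^ k \<le> D ^ k * tag l e i" "D ^ k * tag l e i \<le> D ^ m"
    if "l \<le> 3" "i \<le> t" "m = Suc k" for k l i m
  proof -
    show "D ^ k \<le> D ^ k * tag l e i" using tag(1)[OF that(1,2)] by simp
    have "D ^ k * tag l e i \<le> D ^ k * D" using tag(2)[OF that(1,2)] ED by (intro mult_le_mono2) simp
    then show "D ^ k * tag l e i \<le> D ^ m" using that(3) by (simp add: mult.commute)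
  qed
  define a where "a = elt 0 e 0"
  have a_le: "a \<le> E" using tag(2)[of 0 0] by (simp add: a_def elt_def)
  define w where "w i = 8 * (E - i)" for i
  have b_eq: "elt 1 e i = D ^ w i * tag 1 e i" for i
    by (simp add: elt_def w_def flip: E_def pw)
  have c_eq: "elt k e i = D ^ (w i + 4) * tag k e i" if "k \<in> {2, 3}" for k i
    using that by (auto simp: elt_def w_def simp flip: E_def pw)
  have N2_eq: "idx 1 e i = D ^ (w i + 4) * tag 1 e i" for i
    by (simp add: idx_def w_def flip: E_def pw)
  have N1_eq: "idx 0 e 0 = D ^ (8 * E + 8) * tag 0 e 0"
    by (simp add: idx_def flip: E_def pw)
  have b_low: "D ^ w i \<le> elt 1 e i" and b_high: "elt 1 e i \<le> D ^ (w i + 1)" if "i \<le> t" for i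
    unfolding b_eq by (rule scaled; use that in simp)+
  have c_low: "D ^ (w i + 4) \<le> elt k e i" and c_high: "elt k e i \<le> D ^ (w i + 5)" if "i \<le> t" "k \<in> {2, 3}" for i k
    unfolding c_eq[OF that(2)] by (rule scaled; use that in auto)+
  have N2_low: "D ^ (w i + 4) \<le> idx 1 e i" and N2_high: "idx 1 e i \<le> D ^ (w i + 5)" if "i \<le> t" for i
    unfolding N2_eq by (rule scaled; use that in simp)+
  have N1_low: "D ^ (8 * E + 8) \<le> idx 0 e 0"
    unfolding N1_eq by (rule scaled(1)[OF _ _ refl]) simp_all
  have up: "D ^ k \<le> D ^ l" if "k \<le> l" for k l using that D4 by (intro power_increasing) auto
  have win_low: "D ^ w i \<le> y" and win_high: "y \<le> D ^ (w i + 5)" if "i \<le> t" "y \<in> window e i" for i y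
  proof -
    show "D ^ w i \<le> y"
      using that(2) b_low[OF that(1)] c_low[OF that(1), of 2] c_low[OF that(1), of 3] up[of "w i" "w i + 4"]
      unfolding window_def by auto
    show "y \<le> D ^ (w i + 5)"
      using that(2) b_high[OF that(1)] c_high[OF that(1), of 2] c_high[OF that(1), of 3] up[of "w i + 1" "w i + 5"]
      unfolding window_def by auto
  qed
  have w8: "8 \<le> w i" if "i \<le> t" for i using that t(2) by (simp add: w_def E_def)

  \<comment> \<open>A value above \<open>D * C\<close> that is queried or output within
    \<open>E\<close> steps confines the message length from both sides.\<close>
  have vals: "v \<le> D * C \<or> (length s \<le> v + D * C \<and> v \<le> D * (length s + C))"
    if "\<forall>x\<in>set s. x \<le> C" "E \<le> C"
      "v \<in> queried Or M s E \<or> halts Or M s \<and> steps Or M s \<le> E \<and> v = out_nat Or M s" for s C v Or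
  proof -
    have C1: "1 \<le> C" and Mc: "\<And>r c. Const r c \<in> set M \<Longrightarrow> c \<le> C"
      using that(2) E2 M_consts by (auto simp: E_def intro: le_trans)
    have aff: "(\<forall>r. affine (length s) C u (fst (snd (run Or M s u)) r)) \<and>
        (\<forall>q\<in>fst ` set (snd (snd (run Or M s u))). affine (length s) C u q)" for u
      by (rule run_affine[OF that(1) _ C1]) (rule Mc)
    have "affine (length s) C E v"
      using that(3)
    proof
      assume "v \<in> queried Or M s E"
      then show ?thesis using aff unfolding queried_def by blast
    next
      assume h: "halts Or M s \<and> steps Or M s \<le> E \<and> v = out_nat Or M s"
      have "affine (length s) C (steps Or M s) (out_nat Or M s)"
        using aff unfolding out_nat_def final_mem_def by blast
      then show ?thesis using affine_mono h by blast
    qed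
    then show ?thesis using affine_cases unfolding D_def by blast
  qed

  let ?A = "{a}" and ?f = "\<lambda>_::nat. a"
  define s where "s j = tout M T ?A ?f j" for j
  have A: "?A = lang 0 e 0" by (simp add: lang_def a_def)
  have enA: "is_enum (lang 0 e 0) ?f" unfolding A[symmetric] is_enum_def by auto
  have s_mono: "length (s j) \<le> length (s j')" if "j \<le> j'" for j j'
    using tout_length_mono[OF _ enA that] unfolding s_def A by simp
  have s_le: "\<forall>x\<in>set (s j). x \<le> E" for j
    using tout_set[OF _ enA, of j] a_le unfolding s_def A[symmetric] by auto
  obtain n1 where n1: "converges fam M T (poly p (idx 0 e 0)) ?A ?f n1"
    using lang_converges[OF _ enA order_refl] unfolding A by auto
  have "fam (out_nat ?A M (s n1)) = lang 0 e 0"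
    unfolding A[symmetric] s_def using n1 unfolding converges_def by (elim conjE)
  then have outA: "out_nat ?A M (s n1) = idx 0 e 0" by (rule fam_eq_lang) simp
  have small: "D * E < D ^ 8"
  proof -
    have "D * E \<le> D ^ 2" using ED by (simp add: power2_eq_square)
    also have "\<dots> < D ^ 8" using D4 by (intro power_strict_increasing) auto
    finally show ?thesis .
  qed
  have quietA: "quiet (lang k e i) ?A M u (s j)"
    if "queried ?A M (s j) E \<inter> window e i = {}" "k \<in> {2, 3}" "u \<le> E" for k i j u
  proof -
    have "quiet (lang k e i) ?A M E (s j)"
      using that(1,2) unfolding quiet_def lang_def window_def a_def by auto
    then show ?thesis using quiet_mono that(3) by blast
  qed
  have tE: "t \<le> E" using t(2) by (simp add: E_def)

  define asks0 where "asks0 j \<longleftrightarrow> queried ?A M (s j) E \<inter> window e 0 \<noteq> {}" for j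
  \<comment> \<open>The first round that queries window 0 within \<open>E\<close> steps, or else the
    round just after convergence on \<open>{a}\<close>. Before it the triples of window 0 are not
    separated, so the total cost is below \<open>t\<close>.\<close>
  define r where "r = (if \<exists>j. asks0 j then LEAST j. asks0 j else Suc n1)"
  have before_r: "\<not> asks0 j" if "j < r" for j
    using that not_less_Least unfolding r_def by (auto split: if_splits)
  have fast0: "(\<forall>j<r. halts ?A M (s j)) \<and> (\<Sum>x\<in>s ` {..<r}. steps ?A M x) < t"
    unfolding s_def
  proof (rule unqueried_is_fast[OF t(1)])
    show "a \<in> {elt 0 e 0, elt 1 e 0}" by (simp add: a_def)
    show "quiet (lang k e 0) ?A M t (tout M T ?A ?f j)" if "j < r" "k \<in> {2, 3}" for j k
      using quietA[of j 0 k t] before_r[OF that(1)] that(2) tE unfolding asks0_def s_def by blast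
  qed
  then have steps0: "steps ?A M (s j) < t" if "j < r" for j
    using member_le_sum[of "s j" "s ` {..<r}" "steps ?A M"] that by fastforce
  \<comment> \<open>Either a number of window 0 was queried in round \<open>r\<close>, or the index
    of \<open>{a}\<close> was output quickly one round earlier; both need a long message.\<close>
  have long: "D ^ (8 * E) \<le> D * (length (s r) + D)"
  proof (cases "\<exists>j. asks0 j")
    case True
    then have "asks0 r" unfolding r_def using LeastI_ex[of asks0] by simp
    then obtain x where x: "x \<in> queried ?A M (s r) E" "x \<in> window e 0" unfolding asks0_def by blast
    have "D ^ (8 * E) \<le> x" using win_low[of 0 x] x(2) by (simp add: w_def)
    moreover have "D ^ 8 \<le> D ^ (8 * E)" using E2 by (intro up) simp
    ultimately have "x \<le> D * (length (s r) + E)"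
      using vals[OF s_le order_refl, of x ?A r] x(1) small by auto
    then show ?thesis using \<open>D ^ (8 * E) \<le> x\<close> ED by (meson add_le_mono le_trans mult_le_mono2 order_refl)
  next
    case False
    then have r: "r = Suc n1" by (simp add: r_def)
    have h: "halts ?A M (s n1)" "steps ?A M (s n1) \<le> E"
      using fast0 steps0[of n1] tE r by auto
    have "D ^ 8 \<le> D ^ (8 * E + 8)" by (intro up) simp
    then have "idx 0 e 0 \<le> D * (length (s n1) + E)"
      using vals[OF s_le order_refl, of "idx 0 e 0" ?A n1] h outA small N1_low by auto
    moreover have "D ^ (8 * E) \<le> D ^ (8 * E + 8)" by (intro up) simp
    moreover have "D * (length (s n1) + E) \<le> D * (length (s r) + D)"
      using s_mono[of n1 r] r ED by (intro mult_le_mono2 add_le_mono) auto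
    ultimately show ?thesis using N1_low by linarith
  qed
  \<comment> \<open>Pigeonhole: fewer than \<open>t\<close> numbers are queried before round
    \<open>r\<close>, while the windows 1 to \<open>t\<close> are pairwise disjoint.\<close>
  obtain i where i: "1 \<le> i" "i \<le> t" "\<And>j. j < r \<Longrightarrow> queried ?A M (s j) E \<inter> window e i = {}"
  proof -
    define Q where "Q = (\<Union>x\<in>s ` {..<r}. queried ?A M x (steps ?A M x))"
    have "finite Q" unfolding Q_def queried_def by auto
    have "card Q \<le> (\<Sum>x\<in>s ` {..<r}. card (queried ?A M x (steps ?A M x)))"
      unfolding Q_def by (intro card_UN_le) simp
    also have "\<dots> \<le> (\<Sum>x\<in>s ` {..<r}. steps ?A M x)" by (intro sum_mono card_queried_le)
    finally have Q: "card Q < t" using fast0 by simp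
    have "\<exists>i\<in>{1..t}. window e i \<inter> Q = {}"
    proof (rule ccontr)
      assume "\<not> ?thesis"
      then have "\<forall>i\<in>{1..t}. \<exists>y. y \<in> window e i \<inter> Q" by blast
      then obtain y where y: "\<And>i. i \<in> {1..t} \<Longrightarrow> y i \<in> window e i \<inter> Q" by metis
      have "inj_on y {1..t}" using y window_disjoint by (intro inj_onI) (metis IntD1)
      then have "card {1..t} \<le> card Q" using y \<open>finite Q\<close> by (intro card_inj_on_le) auto
      then show False using Q by simp
    qed
    then obtain i where i: "i \<in> {1..t}" "window e i \<inter> Q = {}" by blast
    have "queried ?A M (s j) E \<subseteq> Q" if "j < r" for j
      using queried_halted[of ?A M "s j" E] fast0 steps0[OF that] tE that unfolding Q_def by auto
    then show ?thesis using i by (intro that[of i]) auto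
  qed
  have wi: "w i + 5 + 3 \<le> 8 * E" using i(1,2) tE t(2) unfolding w_def by simp
  \<comment> \<open>From round \<open>r\<close> on, messages are too long: a query in window
    \<open>i\<close> would bound the length by \<open>2 * D ^ (w i + 5)\<close>, and
    \<open>i >= 1\<close> puts this far below window 0.\<close>
  have unasked: "queried ?A M (s j) E \<inter> window e i = {}" for j
  proof (cases "j < r")
    case False
    show ?thesis
    proof (rule ccontr)
      assume "\<not> ?thesis"
      then obtain y where y: "y \<in> queried ?A M (s j) E" "y \<in> window e i" by blast
      have "D * E < y" using small win_low[OF i(2) y(2)] up[OF w8[OF i(2)]] by simp
      then have "length (s j) \<le> y + D * E" using vals[OF s_le order_refl, of y ?A j] y(1) by auto
      also have "\<dots> \<le> 2 * D ^ (w i + 5)"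
        using win_high[OF i(2) y(2)] small up[of 8 "w i + 5"] w8[OF i(2)] by simp
      finally have "length (s r) \<le> 2 * D ^ (w i + 5)" using s_mono[of r j] False by simp
      then have "D * (length (s r) + D) < D ^ (8 * E)"
        by (intro power_gap[OF D4, of "w i + 5"]) (use wi in auto)
      then show False using long by simp
    qed
  qed (use i(3) in blast)
  have pE: "poly p (tag 3 e i) \<le> E"
    using poly_nat_mono[OF tag_mono[OF order_refl i(2)], of p e] t(4) by (simp add: E_def)
  \<comment> \<open>Window \<open>i\<close> is never asked, so even convergence on
    \<open>{a}\<close> must cost less than \<open>E\<close>.\<close>
  have fastA: "(\<forall>j<Suc n1. halts ?A M (s j)) \<and> (\<Sum>x\<in>s ` {..<Suc n1}. steps ?A M x) < E"
    unfolding s_def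
  proof (rule unqueried_is_fast[OF pE])
    show "a \<in> {elt 0 e 0, elt 1 e i}" by (simp add: a_def)
    show "quiet (lang k e i) ?A M E (tout M T ?A ?f j)" if "k \<in> {2, 3}" for j k
      using quietA[OF unasked that order_refl] unfolding s_def .
  qed
  then have stepsA: "steps ?A M (s j) \<le> E" if "j \<le> n1" for j
    using member_le_sum[of "s j" "s ` {..<Suc n1}" "steps ?A M"] that by fastforce
  \<comment> \<open>Round \<open>n1\<close> itself must be shown long, since \<open>r\<close> may
    come later and only rounds up to \<open>n1\<close> will be shared with the enumeration of
    \<open>{a, b}\<close>.\<close>
  have long1: "D ^ (8 * E + 8) \<le> D * (length (s n1) + D)"
  proof -
    have "D ^ 8 \<le> D ^ (8 * E + 8)" by (intro up) simp
    then have "idx 0 e 0 \<le> D * (length (s n1) + E)"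
      using vals[OF s_le order_refl, of "idx 0 e 0" ?A n1] fastA stepsA outA small N1_low by auto
    moreover have "D * (length (s n1) + E) \<le> D * (length (s n1) + D)"
      using ED by (intro mult_le_mono2 add_le_mono) auto
    ultimately show ?thesis using N1_low by linarith
  qed

  define b where "b = elt 1 e i"
  let ?B = "{a, b}"
  \<comment> \<open>The element \<open>b\<close> is withheld until convergence on
    \<open>{a}\<close>, so the long message is inherited.\<close>
  define g where "g j = (if j \<le> n1 then a else b)" for j
  define z where "z j = tout M T ?B g j" for j
  have B: "?B = lang 1 e i" by (simp add: lang_def a_def b_def)
  have "g 0 = a" "g (Suc n1) = b" by (simp_all add: g_def)
  then have "?B \<subseteq> range g" by (metis empty_subsetI insert_subset rangeI)
  moreover have "range g \<subseteq> ?B" by (auto simp: g_def)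
  ultimately have "range g = ?B" by (rule equalityI[rotated])
  then have enB: "is_enum (lang 1 e i) g" unfolding B[symmetric] is_enum_def by simp
  have quietB: "quiet ?B ?A M E (s j)" for j
    using unasked[of j] unfolding quiet_def window_def b_def by auto
  have zs: "z j = s j" if "j \<le> n1" for j
    unfolding z_def s_def
  proof (rule tout_agree[of "Suc n1"])
    show "g l = a" if "l < Suc n1" for l using that by (simp add: g_def)
    show "quiet ?B ?A M E (tout M T ?A ?f l)" for l using quietB unfolding s_def .
    show "halts ?B M (tout M T ?B g l) \<and> steps ?B M (tout M T ?B g l) \<le> E \<or>
        halts ?A M (tout M T ?A ?f l) \<and> steps ?A M (tout M T ?A ?f l) \<le> E" if "l < Suc n1" for l
      using fastA stepsA[of l] that unfolding s_def by simp
  qed (use that in simp)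
  \<comment> \<open>Messages may now contain \<open>b\<close>, which takes over the role of
    \<open>C\<close> in \<open>vals\<close>.\<close>
  have bE: "E \<le> b" and b_high': "b \<le> D ^ (w i + 1)"
  proof -
    have "E \<le> D ^ 1" using ED by simp
    also have "\<dots> \<le> D ^ w i" using w8[OF i(2)] by (intro up) simp
    also have "\<dots> \<le> b" using b_low[OF i(2)] by (simp add: b_def)
    finally show "E \<le> b" .
  qed (use b_high[OF i(2)] in \<open>simp add: b_def\<close>)
  have z_le: "\<forall>x\<in>set (z j). x \<le> b" for j
    using tout_set[OF _ enB, of j] a_le bE unfolding z_def B[symmetric] by auto
  have Db: "D * b < D ^ (w i + 4)"
  proof -
    have "D * b \<le> D * D ^ (w i + 1)" using b_high' by (rule mult_le_mono2)
    also have "\<dots> = D ^ (w i + 2)" by simp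
    also have "\<dots> < D ^ (w i + 4)" using D4 by (intro power_strict_increasing) auto
    finally show ?thesis .
  qed
  \<comment> \<open>This range contains the third elements of both triples and the index of the
    pair.\<close>
  have no_val: False
    if j: "n1 \<le> j" and v: "D ^ (w i + 4) \<le> v" "v \<le> D ^ (w i + 5)"
      "v \<in> queried ?B M (z j) E \<or> halts ?B M (z j) \<and> steps ?B M (z j) \<le> E \<and> v = out_nat ?B M (z j)" for j v
  proof -
    have "length (z j) \<le> v + D * b" using vals[OF z_le bE v(3)] v(1) Db by auto
    also have "\<dots> \<le> 2 * D ^ (w i + 5)" using v(2) Db up[of "w i + 4" "w i + 5"] by simp
    finally have "length (z n1) \<le> 2 * D ^ (w i + 5)"
      using tout_length_mono[OF _ enB j] unfolding z_def B by simp
    then have "D * (length (s n1) + D) < D ^ (8 * E + 8)"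
      unfolding zs[OF order_refl] by (intro power_gap[OF D4, of "w i + 5"]) (use wi in auto)
    then show False using long1 by simp
  qed
  \<comment> \<open>Up to \<open>n1\<close> the run is the one on \<open>{a}\<close>, where window
    \<open>i\<close> is unasked; afterwards \<open>no_val\<close> applies.\<close>
  have quietC: "quiet (lang k e i) ?B M E (z j)" if k: "k \<in> {2, 3}" for j k
  proof -
    have "elt k e i \<notin> queried ?B M (z j) E"
    proof (cases "j \<le> n1")
      case True
      then have "queried ?B M (z j) E = queried ?A M (s j) E"
        unfolding queried_def zs[OF True] by (simp add: run_agree[OF quietB])
      then show ?thesis using unasked[of j] k unfolding window_def by auto
    next
      case False
      then show ?thesis using no_val[of j "elt k e i"] c_low[OF i(2) k] c_high[OF i(2) k] by auto
    qed
    then show ?thesis using k unfolding quiet_def lang_def a_def b_def by auto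
  qed
  obtain n2 where n2: "converges fam M T (poly p (idx 1 e i)) ?B g n2"
    using lang_converges[OF _ enB order_refl] unfolding B by auto
  \<comment> \<open>Late enough for convergence on the pair as well as for long messages: the output
    is reached within \<open>E\<close> steps, against \<open>no_val\<close>.\<close>
  define N where "N = max n1 n2"
  have fastB: "(\<forall>j<Suc N. halts ?B M (z j)) \<and> (\<Sum>x\<in>z ` {..<Suc N}. steps ?B M x) < E"
    unfolding z_def
  proof (rule unqueried_is_fast[OF pE])
    show "g j \<in> {elt 0 e 0, elt 1 e i}" for j by (simp add: g_def a_def b_def)
    show "quiet (lang k e i) ?B M E (tout M T ?B g j)" if "k \<in> {2, 3}" for j k
      using quietC[OF that] unfolding z_def .
  qed
  then have "steps ?B M (z N) \<le> E"
    using member_le_sum[of "z N" "z ` {..<Suc N}" "steps ?B M"] by fastforce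
  moreover have "out_nat ?B M (z N) = idx 1 e i"
  proof -
    have "\<forall>j\<ge>n2. halts ?B M (z j) \<and> out_nat ?B M (z j) = out_nat ?B M (z n2)"
      using n2 unfolding converges_def z_def by (elim conjE)
    moreover have "n2 \<le> N" by (simp add: N_def)
    ultimately have "out_nat ?B M (z N) = out_nat ?B M (z n2)" by blast
    moreover have "fam (out_nat ?B M (z n2)) = lang 1 e i"
      unfolding B[symmetric] z_def using n2 unfolding converges_def by (elim conjE)
    then have "out_nat ?B M (z n2) = idx 1 e i" by (rule fam_eq_lang) simp
    ultimately show ?thesis by simp
  qed
  ultimately show False
    using no_val[of N "idx 1 e i"] N2_low[OF i(2)] N2_high[OF i(2)] fastB by (auto simp: N_def)
qed

end

theorem theorem4p7:
  shows "\<exists>F :: nat \<Rightarrow> nat set. PSD F \<and> \<not> PRT_TO F"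
proof (intro exI conjI)
  show "PSD fam" by (rule PSD_fam)
  show "\<not> PRT_TO fam"
  proof
    assume "PRT_TO fam"
    then obtain M T p where "oracle_learner M T p"
      unfolding PRT_TO_def oracle_learner_def by (elim conjE exE)
    then show False by (rule oracle_learner.no_success)
  qed
qed

end
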